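(* Let $D$ be a weakly connected, source-sink connected (finite or infinite) digraph. (a) If $\mathfrak{B}_{\mathrm{fin}}$ is the set of all dicuts of $D$ of finite size and $\mathfrak{B}_{\mathrm{fin}}\ne\emptyset$, then $D$ is $\mathfrak{B}_{\mathrm{fin}}$-woodall. (b) If $c$ is a capacity of $D$, $\mathfrak{B}_{\mathrm{fin}}$ is the set of all dicuts of $D$ of finite capacity, and $\mathfrak{B}_{\mathrm{fin}}\ne\emptyset$, then $D$ is $\mathfrak{B}_{\mathrm{fin}}$-woodall with respect to $c$.
   Context: Digraphs may have parallel edges, but no loops. $D$ is weakly connected if its underlying undirected multigraph is connected. For disjoint $X,Y$ with $X\cup Y=V(D)$, $E_D(X,Y)$ is the set of edges with one endvertex in $X$ and the other in $Y$. A cut is a set $B=E_D(X,Y)$ where $X,Y$ are non-empty, disjoint and have union $V(D)$. A dicut is a cut $B=E_D(X,Y)$ all of whose edges have their heads in the same one of the sides $X,Y$. An out-ray is a one-way infinite path $v_0v_1v_2\dots$ with all edges directed from $v_i$ to $v_{i+1}$; a back-ray is a one-way infinite path with all edges directed from $v_{i+1}$ to $v_i$. A strongly connected component $C$ of $D$ is a source component if no edge of $D$ has its head in $V(C)$ and its tail outside $V(C)$; it is a sink component if no edge of $D$ has its tail in $V(C)$ and its head outside $V(C)$. A weakly connected digraph $D$ is source-sink connected if for every $C^+$ that is either a source component or a back-ray of $D$, and every $C^-$ that is either a sink component or an out-ray of $D$, there is a (possibly trivial) directed path from $C^+$ to $C^-$ in $D$. For a non-empty set $\mathfrak{B}$ of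 dicuts, a $\mathfrak{B}$-dijoin is a set of edges meeting every element of $\mathfrak{B}$, and $D$ is $\mathfrak{B}$-woodall if the minimum size of an element of $\mathfrak{B}$ equals the maximum size of a set of pairwise disjoint $\mathfrak{B}$-dijoins. A capacity of $D$ is a map $c$ from $E(D)$ to a set of (finite or infinite) cardinals. For $A\subseteq E(D)$, $c(A)$ is the cardinal sum of the $c(e)$, $e\in A$; $A$ has finite capacity if $c(A)$ is finite. A family $(F_i)_{i\in I}$ of (not necessarily distinct) sets of edges is $c$-disjoint if every edge $e$ lies in $F_i$ for at most $c(e)$ indices $i\in I$; the size of the family is $|I|$. $D$ is $\mathfrak{B}$-woodall with respect to $c$ if the minimum of $c(B)$ over $B\in\mathfrak{B}$ equals the maximum size of a $c$-disjoint family of $\mathfrak{B}$-dijoins. *)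

theory Defs
  imports "Graph_Theory.Digraph_Component"
begin

section \<open>Rays and source-sink connectivity\<close>

text \<open>
  Sizes are compared with the cardinal orders of \<open>Main\<close>: \<open>|A|\<close> is the cardinal of \<open>A\<close>,
  and \<open>=o\<close>, \<open>\<le>o\<close> compare cardinals living on possibly different types.
\<close>

unbundle cardinal_syntax

text \<open>A ray is given by its vertex sequence \<open>v\<close> and its edge sequence \<open>e\<close>.\<close>

definition out_ray :: "('a,'b) pre_digraph \<Rightarrow> (nat \<Rightarrow> 'a) \<Rightarrow> (nat \<Rightarrow> 'b) \<Rightarrow> bool" where
  "out_ray D v e \<longleftrightarrow> inj v \<and>
     (\<forall>i. e i \<in> arcs D \<and> tail D (e i) = v i \<and> head D (e i) = v (Suc i))"

definition back_ray :: "('a,'b) pre_digraph \<Rightarrow> (nat \<Rightarrow> 'a) \<Rightarrow> (nat \<Rightarrow> 'b) \<Rightarrow> bool" where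
  "back_ray D v e \<longleftrightarrow> inj v \<and>
     (\<forall>i. e i \<in> arcs D \<and> tail D (e i) = v (Suc i) \<and> head D (e i) = v i)"

definition source_component :: "('a,'b) pre_digraph \<Rightarrow> ('a,'b) pre_digraph \<Rightarrow> bool" where
  "source_component D C \<longleftrightarrow> C \<in> pre_digraph.sccs D \<and>
     \<not> (\<exists>e\<in>arcs D. head D e \<in> verts C \<and> tail D e \<notin> verts C)"

definition sink_component :: "('a,'b) pre_digraph \<Rightarrow> ('a,'b) pre_digraph \<Rightarrow> bool" where
  "sink_component D C \<longleftrightarrow> C \<in> pre_digraph.sccs D \<and>
     \<not> (\<exists>e\<in>arcs D. tail D e \<in> verts C \<and> head D e \<notin> verts C)"

text \<open>Vertex sets of the subgraphs that may serve as \<open>C\<^sup>+\<close> and as \<open>C\<^sup>-\<close>, respectively.\<close>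

definition source_vsets :: "('a,'b) pre_digraph \<Rightarrow> 'a set set" where
  "source_vsets D = {verts C |C. source_component D C} \<union> {range v |v. \<exists>e. back_ray D v e}"

definition sink_vsets :: "('a,'b) pre_digraph \<Rightarrow> 'a set set" where
  "sink_vsets D = {verts C |C. sink_component D C} \<union> {range v |v. \<exists>e. out_ray D v e}"

text \<open>The arc list \<open>p\<close> of an \<open>apath\<close> may be empty, which gives the trivial path.\<close>

definition source_sink_connected :: "('a,'b) pre_digraph \<Rightarrow> bool" where
  "source_sink_connected D \<longleftrightarrow>
     (\<forall>S\<in>source_vsets D. \<forall>T\<in>sink_vsets D. \<exists>s\<in>S. \<exists>t\<in>T. \<exists>p. pre_digraph.apath D s p t)"


section \<open>Dicuts and dijoins\<close>

definition edges_between :: "('a,'b) pre_digraph \<Rightarrow> 'a set \<Rightarrow> 'a set \<Rightarrow> 'b set" where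
  "edges_between D X Y = {e \<in> arcs D.
     (tail D e \<in> X \<and> head D e \<in> Y) \<or> (tail D e \<in> Y \<and> head D e \<in> X)}"

definition cut_sides :: "('a,'b) pre_digraph \<Rightarrow> 'a set \<Rightarrow> 'a set \<Rightarrow> bool" where
  "cut_sides D X Y \<longleftrightarrow> X \<noteq> {} \<and> Y \<noteq> {} \<and> X \<inter> Y = {} \<and> X \<union> Y = verts D"

definition dicut :: "('a,'b) pre_digraph \<Rightarrow> 'b set \<Rightarrow> bool" where
  "dicut D B \<longleftrightarrow> (\<exists>X Y. cut_sides D X Y \<and> B = edges_between D X Y \<and>
     ((\<forall>e\<in>B. head D e \<in> X) \<or> (\<forall>e\<in>B. head D e \<in> Y)))"

definition dijoin :: "('a,'b) pre_digraph \<Rightarrow> 'b set set \<Rightarrow> 'b set \<Rightarrow> bool" where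
  "dijoin D \<BB> F \<longleftrightarrow> F \<subseteq> arcs D \<and> (\<forall>B\<in>\<BB>. F \<inter> B \<noteq> {})"

definition disjoint_dijoins :: "('a,'b) pre_digraph \<Rightarrow> 'b set set \<Rightarrow> 'b set set \<Rightarrow> bool" where
  "disjoint_dijoins D \<BB> \<J> \<longleftrightarrow> (\<forall>F\<in>\<J>. dijoin D \<BB> F) \<and> pairwise disjnt \<J>"

text \<open>\<open>B\<close> has minimum size in \<open>\<BB>\<close> and \<open>\<J>\<close> has maximum size; attainment of the maximum is part
  of the claim.\<close>

definition woodall :: "('a,'b) pre_digraph \<Rightarrow> 'b set set \<Rightarrow> bool" where
  "woodall D \<BB> \<longleftrightarrow> (\<exists>B \<J>.
     B \<in> \<BB> \<and> (\<forall>B'\<in>\<BB>. |B| \<le>o |B'| ) \<and>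
     disjoint_dijoins D \<BB> \<J> \<and> (\<forall>\<J>'. disjoint_dijoins D \<BB> \<J>' \<longrightarrow> |\<J>'| \<le>o |\<J>| ) \<and>
     |B| =o |\<J>| )"


section \<open>Capacities\<close>

text \<open>
  A cardinal is represented by a cardinal order \<open>r\<close> on a subset of a type \<open>'k\<close>; finite
  cardinals, including zero, are allowed. Every set of cardinals is represented on some type,
  so leaving \<open>'k\<close> arbitrary is no restriction.
\<close>

definition capacity :: "('a,'b) pre_digraph \<Rightarrow> ('b \<Rightarrow> 'k rel) \<Rightarrow> bool" where
  "capacity D c \<longleftrightarrow> (\<forall>e\<in>arcs D. Card_order (c e))"

definition cap_sum :: "('b \<Rightarrow> 'k rel) \<Rightarrow> 'b set \<Rightarrow> ('b \<times> 'k) rel" where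
  "cap_sum c A = (CSUM e : |A|. c e)"

definition finite_capacity :: "('b \<Rightarrow> 'k rel) \<Rightarrow> 'b set \<Rightarrow> bool" where
  "finite_capacity c A \<longleftrightarrow> finite (Field (cap_sum c A))"

definition c_disjoint ::
    "('a,'b) pre_digraph \<Rightarrow> ('b \<Rightarrow> 'k rel) \<Rightarrow> 'i set \<Rightarrow> ('i \<Rightarrow> 'b set) \<Rightarrow> bool" where
  "c_disjoint D c I F \<longleftrightarrow> (\<forall>e\<in>arcs D. |{i \<in> I. e \<in> F i}| \<le>o c e)"

definition c_disjoint_dijoins ::
    "('a,'b) pre_digraph \<Rightarrow> 'b set set \<Rightarrow> ('b \<Rightarrow> 'k rel) \<Rightarrow> 'i set \<Rightarrow> ('i \<Rightarrow> 'b set) \<Rightarrow> bool" where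
  "c_disjoint_dijoins D \<BB> c I F \<longleftrightarrow> (\<forall>i\<in>I. dijoin D \<BB> (F i)) \<and> c_disjoint D c I F"

text \<open>
  HOL cannot quantify over index types inside a definition. Index sets are therefore taken in
  \<open>'b \<times> 'k\<close>, the type on which cardinal sums live; for a non-empty \<open>\<BB>\<close> this loses nothing by
  \<open>c_disjoint_dijoins_reindex\<close> below.
\<close>

definition woodall_wrt :: "('a,'b) pre_digraph \<Rightarrow> 'b set set \<Rightarrow> ('b \<Rightarrow> 'k rel) \<Rightarrow> bool" where
  "woodall_wrt D \<BB> c \<longleftrightarrow> (\<exists>B (I :: ('b \<times> 'k) set) F.
     B \<in> \<BB> \<and> (\<forall>B'\<in>\<BB>. cap_sum c B \<le>o cap_sum c B') \<and>
     c_disjoint_dijoins D \<BB> c I F \<and>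
     (\<forall>(I' :: ('b \<times> 'k) set) F'. c_disjoint_dijoins D \<BB> c I' F' \<longrightarrow> |I'| \<le>o |I| ) \<and>
     cap_sum c B =o |I| )"

lemma c_disjoint_dijoins_reindex:
  fixes D :: "('a,'b) pre_digraph" and c :: "'b \<Rightarrow> 'k rel" and I :: "'i set"
  assumes B: "B \<in> \<BB>" and fam: "c_disjoint_dijoins D \<BB> c I F" and cap: "capacity D c"
  shows "\<exists>(I' :: ('b \<times> 'k) set) F'. c_disjoint_dijoins D \<BB> c I' F' \<and> |I'| =o |I|"
proof -
  have dj: "\<And>i. i \<in> I \<Longrightarrow> dijoin D \<BB> (F i)" and cd: "c_disjoint D c I F"
    using fam by (auto simp: c_disjoint_dijoins_def)
  have "\<forall>i\<in>I. \<exists>e. e \<in> F i \<and> e \<in> arcs D"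
    using dj B unfolding dijoin_def by blast
  then obtain g where g: "\<And>i. i \<in> I \<Longrightarrow> g i \<in> F i \<and> g i \<in> arcs D"
    by metis
  have "\<exists>h. inj_on h {i \<in> I. e \<in> F i} \<and> h ` {i \<in> I. e \<in> F i} \<subseteq> Field (c e)"
    if e: "e \<in> arcs D" for e
  proof -
    have "|{i \<in> I. e \<in> F i}| \<le>o c e" "Card_order (c e)"
      using cd cap e by (auto simp: c_disjoint_def capacity_def)
    then have "|{i \<in> I. e \<in> F i}| \<le>o |Field (c e)|"
      by (blast intro: card_of_Field_ordIso ordIso_symmetric ordLeq_ordIso_trans)
    then show ?thesis
      by (simp only: card_of_ordLeq[symmetric])
  qed
  then have "\<forall>e\<in>arcs D. \<exists>h :: 'i \<Rightarrow> 'k. inj_on h {i \<in> I. e \<in> F i}"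
    by blast
  from bchoice[OF this] obtain h :: "'b \<Rightarrow> 'i \<Rightarrow> 'k"
    where h: "\<And>e. e \<in> arcs D \<Longrightarrow> inj_on (h e) {i \<in> I. e \<in> F i}"
    by blast
  define f where "f i = (g i, h (g i) i)" for i
  have f: "inj_on f I"
  proof (rule inj_onI)
    fix i j assume ij: "i \<in> I" "j \<in> I" "f i = f j"
    then have "g i = g j" "h (g i) i = h (g i) j" by (auto simp: f_def)
    moreover have "i \<in> {k \<in> I. g i \<in> F k}" "j \<in> {k \<in> I. g i \<in> F k}"
      using ij g[of i] g[of j] \<open>g i = g j\<close> by auto
    ultimately show "i = j"
      using inj_onD[OF h[of "g i"]] g[OF ij(1)] by simp
  qed
  define F' where "F' = F \<circ> inv_into I f"
  have F': "F' (f i) = F i" if "i \<in> I" for i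
    using f that by (simp add: F'_def)
  have "|{i' \<in> f ` I. e \<in> F' i'}| \<le>o c e" if e: "e \<in> arcs D" for e
  proof -
    have "{i' \<in> f ` I. e \<in> F' i'} = f ` {i \<in> I. e \<in> F i}"
      using F' by auto
    then have "|{i' \<in> f ` I. e \<in> F' i'}| \<le>o |{i \<in> I. e \<in> F i}|"
      by (simp add: card_of_image)
    also have "|{i \<in> I. e \<in> F i}| \<le>o c e"
      using cd e by (simp add: c_disjoint_def)
    finally show ?thesis .
  qed
  then have "c_disjoint_dijoins D \<BB> c (f ` I) F'"
    using dj F' by (auto simp: c_disjoint_dijoins_def c_disjoint_def)
  moreover have "|f ` I| =o |I|"
    using f by (rule ordIso_symmetric[OF card_of_ordIsoI[OF inj_on_imp_bij_betw]])
  ultimately show ?thesis by blast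
qed

end

theory Submission
  imports Defs "HOL-Analysis.Function_Topology"
begin

text \<open>
Let \<open>k\<close> be the minimum size of a finite dicut. Disjoint dijoins meet a dicut of size \<open>k\<close> in distinct
edges, so there are at most \<open>k\<close> of them, and it suffices to colour the edges with \<open>k\<close> colours such
that every finite dicut contains every colour: the colour classes are then the dijoins. Capacities
are handled by the same colouring theorem, applied to the copies \<open>(e, x)\<close> of \<open>e\<close> with
\<open>x \<in> Field (c e)\<close>. An edge of capacity zero has no copy, but it still restricts which sets of
vertices induce a dicut; this is why the colouring theorem treats coloured arcs and the lattice of
vertex sets as separate data.

A dicut is the set of edges leaving a down-set, a set of vertices that no edge enters. Down-sets
form a lattice on which the number of leaving edges is submodular. Source-sink connectivity is used
only in the following form (\<open>source_sink_connected_safe\<close>): every down-set \<open>Z\<close> either meets all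
non-empty down-sets, or has a proper union with all proper down-sets. Indeed, if \<open>Z\<close> is disjoint
from a non-empty \<open>X\<close> and \<open>U \<union> Z\<close> is everything for a proper \<open>U\<close>, then \<open>X\<close> contains a source
component or a back-ray, the complement of \<open>U\<close> contains a sink component or an out-ray, and a path
from the former to the latter would enter \<open>Z\<close>.

By compactness (\<open>infinite_full_colouring\<close>) finitely many dicuts may be considered at a time. They
generate a finite lattice of down-sets, and only finitely many edges matter. The finite theorem,
\<open>full_colouring_exists\<close>, is proved by induction on the size of the lattice and the number of arcs.
Call a set tight if exactly \<open>k\<close> arcs leave it. If a tight set \<open>U\<close> is neither an atom nor a coatom,
the sets comparable to \<open>U\<close> in a weak sense form two smaller lattices, whose colourings are glued
along the \<open>k\<close> arcs leaving \<open>U\<close>. An arc that leaves no atom and no coatom can then be deleted, and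
two arcs of which the first leaves only an atom, the second leaves only a coatom, and the second
starts below the end of the first, can be merged into a single one.

If none of this applies, the arcs that leave both an atom and a coatom are coloured first. Their
colouring has to leave enough room for the other arcs, which amounts to two families of demands that
are supermodular on intersecting sets, so that Schrijver's theorem on supermodular colourings
applies (\<open>supermodular_colouring\<close>). It is proved here by exchanging pairs of colours. The remaining
arcs split into two classes that can be coloured independently of each other, each by an argument
modelled on Lovasz's proof of Edmonds' disjoint branchings theorem
(\<open>extend_colouring_from_roots\<close>).
\<close>

section \<open>Colouring with supermodular demands\<close>

definition splits :: "('e \<Rightarrow> bool) \<Rightarrow> 'e set \<Rightarrow> bool" where
  "splits f p \<longleftrightarrow> (\<exists>x\<in>p. \<exists>y\<in>p. f x \<and> \<not> f y)"

lemma splits_pair: "splits f {u, v} \<longleftrightarrow> f u \<noteq> f v"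
  by (auto simp: splits_def)

text \<open>
The union of two matchings is a bipartite graph. The induction removes one edge of the first
matching and joins the partners of its ends in the second matching by a new edge.
\<close>

lemma two_matchings_bicolourable:
  fixes M N :: "'e set set"
  assumes "finite M" "pairwise disjnt M" "\<And>p. p \<in> M \<Longrightarrow> card p = 2"
    and "pairwise disjnt N" "\<And>p. p \<in> N \<Longrightarrow> card p = 2"
  shows "\<exists>f. \<forall>p \<in> M \<union> N. splits f p"
  using assms
proof (induction M arbitrary: N rule: finite_induct)
  case empty
  have "\<forall>p\<in>N. \<exists>x. x \<in> p"
  proof
    fix p assume "p \<in> N"
    then have "p \<noteq> {}" using empty.prems(4)[of p] by auto
    then show "\<exists>x. x \<in> p" by blast
  qed
  then obtain r where r: "\<And>p. p \<in> N \<Longrightarrow> r p \<in> p" by metis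
  have "splits (\<lambda>x. x \<in> r ` N) p" if p: "p \<in> N" for p
  proof -
    obtain x y where xy: "p = {x, y}" "x \<noteq> y"
      using empty.prems(4)[OF p] by (auto simp: card_2_iff)
    then obtain z where z: "z \<in> p" "z \<noteq> r p" by (metis insertCI)
    have "z \<notin> r ` N"
    proof
      assume "z \<in> r ` N"
      then obtain p' where "p' \<in> N" "z = r p'" by blast
      then have "p' \<in> N" "z \<in> p'" "p' \<noteq> p" using r z by auto
      then show False
        using empty.prems(3) p z(1) unfolding pairwise_def disjnt_iff by blast
    qed
    then show ?thesis using r[OF p] p z unfolding splits_def by blast
  qed
  then show ?case by (intro exI[of _ "\<lambda>x. x \<in> r ` N"]) simp
next
  case (insert e M)
  obtain x y where xy: "e = {x, y}" "x \<noteq> y"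
    using insert.prems(2)[of e] by (auto simp: card_2_iff)
  have M: "pairwise disjnt M" "\<And>p. p \<in> M \<Longrightarrow> card p = 2"
    using insert.prems by (auto simp: pairwise_insert)
  have away: "x \<notin> p \<and> y \<notin> p" if "p \<in> M" for p
    using insert.prems(1) insert.hyps(2) that xy
    by (auto simp: pairwise_insert disjnt_iff)
  have Ndis: "p = q" if "p \<in> N" "q \<in> N" "z \<in> p" "z \<in> q" for p q z
    using insert.prems(3) that by (auto simp: pairwise_def disjnt_iff)
  have other: "\<exists>z'. p = {z, z'} \<and> z' \<noteq> z" if p: "p \<in> N" "z \<in> p" for p z
    using insert.prems(4)[OF p(1)] p(2) by (auto simp: card_2_iff)
  have upd: "splits (f(v := s, w := t)) p"
    if "v \<notin> p" "w \<notin> p" "splits f p" for v w p s t and f :: "'e \<Rightarrow> bool"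
    using that unfolding splits_def by (metis fun_upd_other)
  have IH: "\<exists>f. \<forall>p \<in> M \<union> N'. splits f p" if "N' \<subseteq> N" for N'
    using insert.IH[OF M, of N'] pairwise_subset[OF insert.prems(3) that] insert.prems(4) that
    by (meson subsetD)
  consider (both) "e \<in> N"
    | (two) px py where "px \<in> N" "py \<in> N" "x \<in> px" "y \<in> py" "px \<noteq> py"
    | (one) z w pz where "pz \<in> N" "z \<in> pz" "e = {z, w}" "z \<noteq> w" "\<And>p. p \<in> N \<Longrightarrow> w \<notin> p"
    | (none) "\<And>p. p \<in> N \<Longrightarrow> x \<notin> p \<and> y \<notin> p"
  proof (cases "\<exists>p\<in>N. x \<in> p")
    case True
    then obtain px where px: "px \<in> N" "x \<in> px" by blast
    show thesis
    proof (cases "\<exists>p\<in>N. y \<in> p")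
      case True
      then obtain py where py: "py \<in> N" "y \<in> py" by blast
      show thesis
      proof (cases "px = py")
        case True
        then have "px = e" using other[OF px] py(2) xy by auto
        then show thesis using both px(1) by simp
      qed (use two px py in blast)
    next
      case False
      then show thesis using one[of px x y] px xy by blast
    qed
  next
    case False
    show thesis
    proof (cases "\<exists>p\<in>N. y \<in> p")
      case True
      then obtain py where "py \<in> N" "y \<in> py" by blast
      moreover have "e = {y, x}" "y \<noteq> x" using xy by auto
      ultimately show thesis using one[of py y x] False by blast
    next
      case no: False
      show thesis using none False no by blast
    qed
  qed
  then show ?case
  proof cases
    case both
    obtain f where f: "\<forall>p \<in> M \<union> (N - {e}). splits f p"
      using IH[of "N - {e}"] by blast
    let ?g = "f(x := True, y := False)"
    have off: "x \<notin> p \<and> y \<notin> p" if "p \<in> N - {e}" for p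
      using Ndis[of p e] both that xy by auto
    have "splits ?g p" if "p \<in> M \<union> (N - {e})" for p
      by (rule upd) (use that f away off in blast)+
    moreover have "splits ?g e" using xy by (auto simp: splits_def)
    ultimately show ?thesis by blast
  next
    case (two px py)
    obtain x' where x': "px = {x, x'}" "x' \<noteq> x" using other two by blast
    obtain y' where y': "py = {y, y'}" "y' \<noteq> y" using other two by blast
    have ne: "x' \<noteq> y'" "x' \<noteq> y" "y' \<noteq> x"
      using Ndis[of px py] two x' y' by auto
    define N' where "N' = insert {x', y'} (N - {px, py})"
    have rest: "x \<notin> p \<and> y \<notin> p \<and> x' \<notin> p \<and> y' \<notin> p" if "p \<in> N - {px, py}" for p
      using that Ndis[of p px] Ndis[of p py] two x' y' by auto
    have "pairwise disjnt N'"
      unfolding N'_def pairwise_insert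
      using pairwise_subset[OF insert.prems(3), of "N - {px, py}"] rest
      unfolding disjnt_iff by blast
    moreover have "card p = 2" if "p \<in> N'" for p
      using that insert.prems(4) ne by (auto simp: N'_def)
    ultimately obtain f where f: "\<forall>p \<in> M \<union> N'. splits f p"
      using insert.IH[OF M, of N'] by blast
    have f': "splits f p" if "p \<in> M \<union> (N - {px, py})" for p
      using f that unfolding N'_def by blast
    let ?g = "f(x := \<not> f x', y := \<not> f y')"
    have "f x' \<noteq> f y'" using f ne by (auto simp: N'_def splits_def)
    moreover have "?g x \<longleftrightarrow> \<not> f x'" "?g y \<longleftrightarrow> \<not> f y'" "?g x' = f x'" "?g y' = f y'"
      using xy(2) x'(2) y'(2) ne by simp_all
    ultimately have "splits ?g e" "splits ?g px" "splits ?g py"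
      unfolding xy(1) x'(1) y'(1) splits_pair by simp_all
    moreover have "splits ?g p" if "p \<in> M \<union> (N - {px, py})" for p
      by (rule upd) (use that f'[OF that] away rest in blast)+
    ultimately show ?thesis by blast
  next
    case (one z w pz)
    obtain z' where z': "pz = {z, z'}" "z' \<noteq> z" using other one by blast
    have "z' \<noteq> w" using one z' by auto
    obtain f where f: "\<forall>p \<in> M \<union> (N - {pz}). splits f p"
      using IH[of "N - {pz}"] by blast
    let ?g = "f(z := \<not> f z', w := f z')"
    have "splits ?g p" if "p \<in> {e, pz}" for p
      using that one z' \<open>z' \<noteq> w\<close> by (auto simp: splits_def)
    moreover have off: "z \<notin> p \<and> w \<notin> p" if "p \<in> M \<union> (N - {pz})" for p
    proof -
      have "z \<in> {x, y}" "w \<in> {x, y}" using one(3) xy by auto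
      then show ?thesis using that away one(1,2,5) Ndis[of p pz z] by auto
    qed
    have "splits ?g p" if "p \<in> M \<union> (N - {pz})" for p
      by (rule upd) (use that f off in blast)+
    ultimately show ?thesis by blast
  next
    case none
    obtain f where f: "\<forall>p \<in> M \<union> N. splits f p"
      using IH[of N] by blast
    let ?g = "f(x := True, y := False)"
    have "splits ?g e" using xy by (auto simp: splits_def)
    moreover have "splits ?g p" if "p \<in> M \<union> N" for p
      by (rule upd) (use that f away none in blast)+
    ultimately show ?thesis by blast
  qed
qed

text \<open>
A demand \<open>(X, p)\<close> asks that at least \<open>p\<close> colours occur on \<open>X\<close>. A set may carry several demands,
which avoids having to take maxima when the sets are images of the members of a lattice.
\<close>

definition intersecting_demands :: "nat \<Rightarrow> 'e set \<Rightarrow> ('e set \<times> int) set \<Rightarrow> bool" where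
  "intersecting_demands k E R \<longleftrightarrow>
     (\<forall>(X, p)\<in>R. X \<subseteq> E \<and> p \<le> int k \<and> p \<le> int (card X)) \<and>
     (\<forall>(X, p)\<in>R. \<forall>(Y, q)\<in>R. X \<inter> Y \<noteq> {} \<longrightarrow>
        (\<exists>m n. (X \<inter> Y, m) \<in> R \<and> (X \<union> Y, n) \<in> R \<and> p + q \<le> m + n))"

definition satisfies :: "('e \<Rightarrow> nat) \<Rightarrow> ('e set \<times> int) set \<Rightarrow> bool" where
  "satisfies col R \<longleftrightarrow> (\<forall>(X, p)\<in>R. p \<le> int (card (col ` X)))"

text \<open>
A colour on the intersection is on both sets. The strict form serves to show that sets with no colour
to spare have all their common colours on the intersection.
\<close>

lemma card_image_submodular:
  assumes "finite X" "finite Y"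
  shows "card (f ` (X \<inter> Y)) + card (f ` (X \<union> Y)) \<le> card (f ` X) + card (f ` Y)"
    and "c \<in> f ` X \<Longrightarrow> c \<in> f ` Y \<Longrightarrow> c \<notin> f ` (X \<inter> Y) \<Longrightarrow>
      card (f ` (X \<inter> Y)) + card (f ` (X \<union> Y)) < card (f ` X) + card (f ` Y)"
proof -
  have *: "card (f ` X) + card (f ` Y) = card (f ` (X \<union> Y)) + card (f ` X \<inter> f ` Y)"
    using card_Un_Int[of "f ` X" "f ` Y"] assms by (simp add: image_Un)
  have sub: "f ` (X \<inter> Y) \<subseteq> f ` X \<inter> f ` Y" by auto
  then show "card (f ` (X \<inter> Y)) + card (f ` (X \<union> Y)) \<le> card (f ` X) + card (f ` Y)"
    using * card_mono[OF _ sub] assms by simp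
  assume "c \<in> f ` X" "c \<in> f ` Y" "c \<notin> f ` (X \<inter> Y)"
  then have "f ` (X \<inter> Y) \<subset> f ` X \<inter> f ` Y" using sub by blast
  then show "card (f ` (X \<inter> Y)) + card (f ` (X \<union> Y)) < card (f ` X) + card (f ` Y)"
    using * psubset_card_mono[of "f ` X \<inter> f ` Y"] assms by simp
qed

text \<open>
The minimal members of the family are disjoint, and each provides one pair. Recolouring with \<open>a\<close> and
\<open>b\<close> in such a way that these pairs stay bicoloured preserves both colours on all members.
\<close>

lemma disjoint_pairs_in_family:
  fixes \<R> :: "'e set set"
  assumes "finite E" and sub: "\<forall>X\<in>\<R>. X \<subseteq> E"
    and inter: "\<forall>X\<in>\<R>. \<forall>Y\<in>\<R>. X \<inter> Y \<noteq> {} \<longrightarrow> X \<inter> Y \<in> \<R>"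
    and ab: "a \<noteq> b" "\<forall>X\<in>\<R>. {a, b} \<subseteq> col ` X"
  shows "\<exists>P. finite P \<and> pairwise disjnt P \<and>
      (\<forall>p\<in>P. card p = 2 \<and> col ` p = {a, b} \<and> (\<exists>X\<in>\<R>. p \<subseteq> X)) \<and> (\<forall>X\<in>\<R>. \<exists>p\<in>P. p \<subseteq> X)"
proof -
  define \<M> where "\<M> = {X \<in> \<R>. \<forall>Y\<in>\<R>. Y \<subseteq> X \<longrightarrow> Y = X}"
  have "\<exists>p. p \<subseteq> X \<and> card p = 2 \<and> col ` p = {a, b}" if X: "X \<in> \<R>" for X
  proof -
    obtain x y where "x \<in> X" "y \<in> X" "col x = a" "col y = b" using ab(2) X by auto
    then show ?thesis using ab(1) by (intro exI[of _ "{x, y}"]) (auto simp: card_2_iff)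
  qed
  then obtain pr where pr: "\<And>X. X \<in> \<R> \<Longrightarrow> pr X \<subseteq> X \<and> card (pr X) = 2 \<and> col ` pr X = {a, b}"
    by metis
  have fin: "finite \<R>"
    using sub \<open>finite E\<close> by (meson PowI finite_Pow_iff finite_subset subsetI)
  have *: "disjnt X Y" if "X \<in> \<M>" "Y \<in> \<M>" "X \<noteq> Y" for X Y
  proof (rule ccontr)
    assume "\<not> disjnt X Y"
    then have "X \<inter> Y \<in> \<R>" using inter that by (auto simp: \<M>_def disjnt_def)
    then have "X \<inter> Y = X" "X \<inter> Y = Y" using that by (auto simp: \<M>_def)
    then show False using that by blast
  qed
  have "disjnt (pr X) (pr Y)" if "X \<in> \<M>" "Y \<in> \<M>" "X \<noteq> Y" for X Y
  proof -
    have "pr X \<subseteq> X" "pr Y \<subseteq> Y" using that pr by (auto simp: \<M>_def)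
    moreover have "X \<inter> Y = {}" using *[OF that] by (simp add: disjnt_def)
    ultimately show ?thesis unfolding disjnt_def by fast
  qed
  then have "pairwise disjnt (pr ` \<M>)"
    unfolding pairwise_def by (metis imageE)
  moreover have "\<exists>p\<in>pr ` \<M>. p \<subseteq> X" if X: "X \<in> \<R>" for X
  proof -
    have "finite {Y \<in> \<R>. Y \<subseteq> X}" "X \<in> {Y \<in> \<R>. Y \<subseteq> X}" using fin X by auto
    from finite_has_minimal2[OF this] obtain Y
      where Y: "Y \<in> \<R>" "Y \<subseteq> X" "\<forall>Z\<in>{Y \<in> \<R>. Y \<subseteq> X}. Z \<subseteq> Y \<longrightarrow> Y = Z"
      by force
    have "Z = Y" if "Z \<in> \<R>" "Z \<subseteq> Y" for Z
      using bspec[OF Y(3), of Z] that subset_trans[OF that(2) Y(2)] by simp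
    then have "Y \<in> \<M>" unfolding \<M>_def using Y(1) by simp
    moreover have "pr Y \<subseteq> X" using pr[OF Y(1)] Y(2) by (meson subset_trans)
    ultimately show ?thesis by (meson imageI)
  qed
  moreover have "\<forall>p\<in>pr ` \<M>. card p = 2 \<and> col ` p = {a, b} \<and> (\<exists>X\<in>\<R>. p \<subseteq> X)"
    using pr by (auto simp: \<M>_def)
  moreover have "finite (pr ` \<M>)" using fin by (auto simp: \<M>_def)
  ultimately show ?thesis by blast
qed

text \<open>
The effect of redistributing two colours \<open>a\<close> and \<open>b\<close>: a set can only lose a colour if it contains
both before and no pair on which the redistribution is controlled.
\<close>

lemma card_recoloured_image:
  fixes col :: "'e \<Rightarrow> nat"
  assumes "finite X" "a \<noteq> b"
    and new: "new = (\<lambda>z. if col z \<in> {a, b} then (if f z then a else b) else col z)"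
  shows "card (col ` X) \<le> card (new ` X) + 1"
    and "\<not> {a, b} \<subseteq> col ` X \<Longrightarrow> card (col ` X) \<le> card (new ` X)"
    and "p \<subseteq> X \<Longrightarrow> col ` p \<subseteq> {a, b} \<Longrightarrow> splits f p \<Longrightarrow>
           card (new ` X) = card (col ` X \<union> {a, b})"
proof -
  have split: "card (g ` X) = card (g ` X - {a, b}) + card (g ` X \<inter> {a, b})" for g :: "'e \<Rightarrow> nat"
    using card_Int_Diff[of "g ` X" "{a, b}"] assms(1) by simp
  have same: "new ` X - {a, b} = col ` X - {a, b}"
  proof (intro equalityI subsetI)
    fix c assume "c \<in> new ` X - {a, b}"
    then show "c \<in> col ` X - {a, b}" unfolding new by (auto split: if_splits)
  next
    fix c assume c: "c \<in> col ` X - {a, b}"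
    then obtain z where "z \<in> X" "col z = c" by blast
    moreover have "new z = col z" using c \<open>col z = c\<close> unfolding new by simp
    ultimately show "c \<in> new ` X - {a, b}" using c by (metis Diff_iff image_eqI)
  qed
  have hit: "new ` X \<inter> {a, b} \<noteq> {}" if "col ` X \<inter> {a, b} \<noteq> {}"
    using that unfolding new by (auto split: if_splits)
  have fin: "finite (new ` X \<inter> {a, b})" "finite (col ` X \<inter> {a, b})" by auto
  have two: "card (col ` X \<inter> {a, b}) \<le> 2"
    using card_mono[of "{a, b}" "col ` X \<inter> {a, b}"] assms(2) by simp
  have pos: "card (new ` X \<inter> {a, b}) \<ge> 1" if "col ` X \<inter> {a, b} \<noteq> {}"
    using hit[OF that] fin by (simp add: Suc_le_eq card_gt_0_iff)
  show "card (col ` X) \<le> card (new ` X) + 1"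
  proof (cases "col ` X \<inter> {a, b} = {}")
    case True
    then have "card (col ` X \<inter> {a, b}) = 0" by (simp only: card.empty)
    then show ?thesis using split[of new] split[of col] unfolding same by linarith
  next
    case False
    then show ?thesis using split[of new] split[of col] two pos[OF False] unfolding same by linarith
  qed
  show "card (col ` X) \<le> card (new ` X)" if "\<not> {a, b} \<subseteq> col ` X"
  proof -
    have "col ` X \<inter> {a, b} \<subset> {a, b}" using that by blast
    then have "card (col ` X \<inter> {a, b}) < card {a, b}" by (intro psubset_card_mono) auto
    then have one: "card (col ` X \<inter> {a, b}) \<le> 1" using assms(2) by simp
    show ?thesis
    proof (cases "col ` X \<inter> {a, b} = {}")
      case True
      then have "card (col ` X \<inter> {a, b}) = 0" by (simp only: card.empty)
      then show ?thesis using split[of new] split[of col] unfolding same by linarith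
    next
      case False
      then show ?thesis using split[of new] split[of col] one pos[OF False] unfolding same by linarith
    qed
  qed
  assume p: "p \<subseteq> X" "col ` p \<subseteq> {a, b}" "splits f p"
  then obtain x y where xy: "x \<in> p" "y \<in> p" "f x" "\<not> f y" unfolding splits_def by blast
  then have "new x = a" "new y = b" using p(2) unfolding new by auto
  then have "{a, b} \<subseteq> new ` X" using xy p(1) by (metis empty_subsetI image_eqI insert_subset subsetD)
  then have "new ` X = col ` X \<union> {a, b}" using same by blast
  then show "card (new ` X) = card (col ` X \<union> {a, b})" by simp
qed

lemma intersecting_demandsD:
  assumes "intersecting_demands k E R" "(X, p) \<in> R"
  shows "X \<subseteq> E" "p \<le> int k" "p \<le> int (card X)"
  using assms unfolding intersecting_demands_def by auto

lemma intersecting_demands_supermodular: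
  assumes "intersecting_demands k E R" "(X, p) \<in> R" "(Y, q) \<in> R" "X \<inter> Y \<noteq> {}"
  obtains m n where "(X \<inter> Y, m) \<in> R" "(X \<union> Y, n) \<in> R" "p + q \<le> m + n"
proof -
  have "\<forall>z\<in>R. \<forall>w\<in>R. fst z \<inter> fst w \<noteq> {} \<longrightarrow> (\<exists>m n. (fst z \<inter> fst w, m) \<in> R \<and>
      (fst z \<union> fst w, n) \<in> R \<and> snd z + snd w \<le> m + n)"
    using assms(1) unfolding intersecting_demands_def by (simp add: split_def)
  from bspec[OF bspec[OF this assms(2)] assms(3)] show thesis
    using assms(4) that by auto
qed

text \<open>
On two intersecting sets that have exactly as many colours as demanded, submodularity of the number
of colours and supermodularity of the demands must both hold with equality.
\<close>

lemma tight_intersection: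
  fixes X Y :: "'e set" and col :: "'e \<Rightarrow> nat"
  defines "q \<equiv> \<lambda>X. int (card (col ` X))"
  assumes "finite X" "finite Y" "m \<le> q (X \<inter> Y)" "n \<le> q (X \<union> Y)" "q X + q Y \<le> m + n"
  shows "m = q (X \<inter> Y)" "col ` X \<inter> col ` Y \<subseteq> col ` (X \<inter> Y)"
proof -
  have le: "q (X \<inter> Y) + q (X \<union> Y) \<le> q X + q Y"
    using card_image_submodular(1)[OF assms(2,3), of col] unfolding q_def by linarith
  then show "m = q (X \<inter> Y)" using assms by linarith
  show "col ` X \<inter> col ` Y \<subseteq> col ` (X \<inter> Y)"
  proof (rule ccontr)
    assume "\<not> col ` X \<inter> col ` Y \<subseteq> col ` (X \<inter> Y)"
    then obtain c where "c \<in> col ` X" "c \<in> col ` Y" "c \<notin> col ` (X \<inter> Y)" by blast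
    from card_image_submodular(2)[OF assms(2,3) this] have "q (X \<inter> Y) + q (X \<union> Y) < q X + q Y"
      unfolding q_def by linarith
    then show False using assms by linarith
  qed
qed

text \<open>
The core of the theorem on supermodular colourings. If all unmet demands of \<open>R\<close> are short by one and
concern sets with a common element, these deficient sets form a lattice. A colour \<open>a\<close> missing on the
largest of them and a colour \<open>b\<close> occurring twice on the smallest one are redistributed. It has to be
ensured that the smallest deficient set obtains both colours, and that every other set with both
colours and no surplus keeps them. In each of the two families this asks for bicoloured disjoint
pairs, so \<open>two_matchings_bicolourable\<close> applies.
\<close>

lemma repair_deficient_demands:
  assumes finE: "finite E" and R: "intersecting_demands k E R" and S: "intersecting_demands k E S"
    and col: "col ` E \<subseteq> {..<k}" and satS: "satisfies col S"
    and short: "\<And>X p. (X, p) \<in> R \<Longrightarrow> int (card (col ` X)) < p \<Longrightarrow>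
                  p = int (card (col ` X)) + 1 \<and> x \<in> X"
  shows "\<exists>new. new ` E \<subseteq> {..<k} \<and> satisfies new S \<and> satisfies new R"
proof -
  let ?q = "\<lambda>X. int (card (col ` X))"
  define \<D> where "\<D> = {X. (X, ?q X + 1) \<in> R}"
  have sub: "X \<subseteq> E" "p \<le> int k" "p \<le> int (card X)" if "(X, p) \<in> R" for X p
    using R that by (auto simp: intersecting_demands_def)
  have subS: "X \<subseteq> E" if "(X, p) \<in> S" for X p
    using S that by (auto simp: intersecting_demands_def)
  have fin: "finite X" if "X \<subseteq> E" for X using finE that by (rule rev_finite_subset)
  have bound: "p \<le> ?q X + 1" "X \<notin> \<D> \<Longrightarrow> p \<le> ?q X" if "(X, p) \<in> R" for X p
    using short[OF that] that unfolding \<D>_def by (cases "?q X < p", auto)+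
  have colsub: "?q (X \<inter> Y) + ?q (X \<union> Y) \<le> ?q X + ?q Y" if "X \<subseteq> E" "Y \<subseteq> E" for X Y
    using card_image_submodular(1)[OF fin fin, OF that, of col] by linarith
  have D_mem: "x \<in> X" "X \<subseteq> E" if "X \<in> \<D>" for X
    using short[of X "?q X + 1"] sub(1) that by (auto simp: \<D>_def)
  have D_closed: "X \<inter> Y \<in> \<D> \<and> X \<union> Y \<in> \<D>" if XY: "X \<in> \<D>" "Y \<in> \<D>" for X Y
  proof -
    have "X \<inter> Y \<noteq> {}" using D_mem XY by blast
    with R XY[unfolded \<D>_def mem_Collect_eq]
    obtain m n where mn: "(X \<inter> Y, m) \<in> R" "(X \<union> Y, n) \<in> R" "?q X + 1 + (?q Y + 1) \<le> m + n"
      by (rule intersecting_demands_supermodular)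
    then have "m = ?q (X \<inter> Y) + 1" "n = ?q (X \<union> Y) + 1"
      using bound(1)[OF mn(1)] bound(1)[OF mn(2)] colsub[of X Y] D_mem XY by auto
    then show ?thesis using mn by (simp add: \<D>_def)
  qed
  show ?thesis
  proof (cases "\<D> = {}")
    case True
    then have "satisfies col R" using bound(2) by (fastforce simp: satisfies_def)
    then show ?thesis using col satS by blast
  next
    case False
    have finD: "finite \<D>"
      using D_mem(2) finE by (meson PowI finite_Pow_iff finite_subset subsetI)
    \<comment> \<open>The deficient sets have a least member \<open>L\<close> and a largest member \<open>U\<close>.\<close>
    obtain L where L: "L \<in> \<D>" "\<And>X. X \<in> \<D> \<Longrightarrow> L \<subseteq> X"
    proof -
      obtain L where "L \<in> \<D>" "\<forall>X\<in>\<D>. X \<subseteq> L \<longrightarrow> X = L"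
        using finite_has_minimal[OF finD False] by blast
      then show thesis using that D_closed by (metis inf_le1 inf_le2)
    qed
    obtain U where U: "U \<in> \<D>" "\<And>X. X \<in> \<D> \<Longrightarrow> X \<subseteq> U"
    proof -
      obtain U where "U \<in> \<D>" "\<forall>X\<in>\<D>. U \<subseteq> X \<longrightarrow> X = U"
        using finite_has_maximal[OF finD False] by blast
      then show thesis using that D_closed by (metis sup_ge1 sup_ge2)
    qed
    have "card (col ` U) < k" using sub(2)[of U "?q U + 1"] U(1) by (auto simp: \<D>_def)
    then have "\<not> {..<k} \<subseteq> col ` U"
      using card_mono[of "col ` U" "{..<k}"] fin[OF D_mem(2)[OF U(1)]] by auto
    then obtain a where a: "a < k" "a \<notin> col ` U" by auto
    have aD: "a \<notin> col ` X" if "X \<in> \<D>" for X using a U that by blast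
    have "card (col ` L) < card L" using sub(3)[of L "?q L + 1"] L(1) by (auto simp: \<D>_def)
    then have "\<not> inj_on col L" using card_image by force
    then obtain b1 b2 where b12: "b1 \<in> L" "b2 \<in> L" "b1 \<noteq> b2" "col b1 = col b2"
      by (auto simp: inj_on_def)
    define b where "b = col b1"
    have bD: "b \<in> col ` X" if "X \<in> \<D>" for X using L(2)[OF that] b12 by (auto simp: b_def)
    have ab: "a \<noteq> b" using aD bD U by blast
    have bk: "b < k" using col D_mem(2)[OF L(1)] b12 by (auto simp: b_def)
    \<comment> \<open>The sets that must not lose a colour. Those above \<open>L\<close> are taken care of by the pair inside \<open>L\<close>.\<close>
    define \<R> where "\<R> = {X. (X, ?q X) \<in> R \<and> {a, b} \<subseteq> col ` X \<and> \<not> L \<subseteq> X}"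
    define \<S> where "\<S> = {X. (X, ?q X) \<in> S \<and> {a, b} \<subseteq> col ` X}"
    have R_inter: "X \<inter> Y \<in> \<R>" if XY: "X \<in> \<R>" "Y \<in> \<R>" "X \<inter> Y \<noteq> {}" for X Y
    proof -
      have XYR: "(X, ?q X) \<in> R" "(Y, ?q Y) \<in> R" using XY by (auto simp: \<R>_def)
      from R this XY(3) obtain m n
        where mn: "(X \<inter> Y, m) \<in> R" "(X \<union> Y, n) \<in> R" "?q X + ?q Y \<le> m + n"
        by (rule intersecting_demands_supermodular)
      have "X \<inter> Y \<notin> \<D>" using XY L(2) by (auto simp: \<R>_def)
      moreover have "X \<union> Y \<notin> \<D>" using XY aD[of "X \<union> Y"] by (auto simp: \<R>_def image_Un)
      ultimately have "m \<le> ?q (X \<inter> Y)" "n \<le> ?q (X \<union> Y)" using mn bound(2) by auto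
      note tight_intersection[OF fin[OF sub(1)[OF XYR(1)]] fin[OF sub(1)[OF XYR(2)]] this mn(3)]
      then show ?thesis using mn(1) XY by (auto simp: \<R>_def)
    qed
    have S_inter: "X \<inter> Y \<in> \<S>" if XY: "X \<in> \<S>" "Y \<in> \<S>" "X \<inter> Y \<noteq> {}" for X Y
    proof -
      have XYS: "(X, ?q X) \<in> S" "(Y, ?q Y) \<in> S" using XY by (auto simp: \<S>_def)
      from S this XY(3) obtain m n
        where mn: "(X \<inter> Y, m) \<in> S" "(X \<union> Y, n) \<in> S" "?q X + ?q Y \<le> m + n"
        by (rule intersecting_demands_supermodular)
      have "m \<le> ?q (X \<inter> Y)" "n \<le> ?q (X \<union> Y)" using mn satS by (auto simp: satisfies_def)
      note tight_intersection[OF fin[OF subS[OF XYS(1)]] fin[OF subS[OF XYS(2)]] this mn(3)]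
      then show ?thesis using mn(1) XY by (auto simp: \<S>_def)
    qed
    have R_L: "X \<inter> L = {}" if X: "X \<in> \<R>" for X
    proof (rule ccontr)
      assume ne: "X \<inter> L \<noteq> {}"
      have XE: "X \<subseteq> E" "L \<subseteq> E" using X sub D_mem(2) L(1) by (auto simp: \<R>_def)
      have "(X, ?q X) \<in> R" "(L, ?q L + 1) \<in> R" using X L(1) by (auto simp: \<R>_def \<D>_def)
      from R this ne obtain m n
        where mn: "(X \<inter> L, m) \<in> R" "(X \<union> L, n) \<in> R" "?q X + (?q L + 1) \<le> m + n"
        by (rule intersecting_demands_supermodular)
      have "X \<inter> L \<notin> \<D>" using L(2)[of "X \<inter> L"] X by (auto simp: \<R>_def)
      moreover have "X \<union> L \<notin> \<D>" using X aD[of "X \<union> L"] by (auto simp: \<R>_def image_Un)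
      ultimately have "m \<le> ?q (X \<inter> L)" "n \<le> ?q (X \<union> L)" using mn bound(2) by auto
      then show False using mn(3) colsub[OF XE] by linarith
    qed
    have "\<forall>X\<in>\<R>. X \<subseteq> E" "\<forall>X\<in>\<R>. {a, b} \<subseteq> col ` X"
      "\<forall>X\<in>\<R>. \<forall>Y\<in>\<R>. X \<inter> Y \<noteq> {} \<longrightarrow> X \<inter> Y \<in> \<R>"
      using sub R_inter by (auto simp: \<R>_def)
    from disjoint_pairs_in_family[OF finE this(1,3) ab this(2)]
    obtain P where P: "finite P" "pairwise disjnt P"
      "\<forall>p\<in>P. card p = 2 \<and> col ` p = {a, b} \<and> (\<exists>X\<in>\<R>. p \<subseteq> X)"
      "\<forall>X\<in>\<R>. \<exists>p\<in>P. p \<subseteq> X"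
      by (elim exE conjE) (rule that)
    have "\<forall>X\<in>\<S>. X \<subseteq> E" "\<forall>X\<in>\<S>. {a, b} \<subseteq> col ` X"
      "\<forall>X\<in>\<S>. \<forall>Y\<in>\<S>. X \<inter> Y \<noteq> {} \<longrightarrow> X \<inter> Y \<in> \<S>"
      using subS S_inter by (auto simp: \<S>_def)
    from disjoint_pairs_in_family[OF finE this(1,3) ab this(2)]
    obtain Q where Q: "finite Q" "pairwise disjnt Q"
      "\<forall>p\<in>Q. card p = 2 \<and> col ` p = {a, b} \<and> (\<exists>X\<in>\<S>. p \<subseteq> X)"
      "\<forall>X\<in>\<S>. \<exists>p\<in>Q. p \<subseteq> X"
      by (elim exE conjE) (rule that)
    have "pairwise disjnt (insert {b1, b2} P)"
      unfolding pairwise_insert using P(2,3) R_L b12 by (fastforce simp: disjnt_iff)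
    moreover have "card p = 2" if "p \<in> insert {b1, b2} P" for p
      using that P(3) b12 by auto
    ultimately obtain f where f: "\<And>p. p \<in> insert {b1, b2} P \<union> Q \<Longrightarrow> splits f p"
      using two_matchings_bicolourable[of "insert {b1, b2} P" Q] P(1) Q(2,3) by blast
    define new where "new = (\<lambda>z. if col z \<in> {a, b} then (if f z then a else b) else col z)"
    note recol = card_recoloured_image[OF _ ab new_def]
    have keep: "card (new ` X) = card (col ` X \<union> {a, b})"
      if "p \<in> insert {b1, b2} P \<union> Q" "p \<subseteq> X" "X \<subseteq> E" for p X
      using recol(3)[of X p] f[OF that(1)] that fin P(3) Q(3) b12 by (auto simp: b_def)
    have "satisfies new S"
      unfolding satisfies_def
    proof (clarify)
      fix X p assume Xp: "(X, p) \<in> S"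
      then have X: "X \<subseteq> E" "finite X" "p \<le> ?q X" using subS fin satS by (auto simp: satisfies_def)
      show "p \<le> int (card (new ` X))"
      proof (cases "{a, b} \<subseteq> col ` X \<and> p = ?q X")
        case True
        then have "X \<in> \<S>" using Xp by (auto simp: \<S>_def)
        then obtain r where "r \<in> Q" "r \<subseteq> X" using Q(4) by blast
        then have "card (new ` X) = card (col ` X \<union> {a, b})" using keep[of r X] X by blast
        also have "col ` X \<union> {a, b} = col ` X" using True by blast
        finally show ?thesis using X by simp
      next
        case False
        then show ?thesis using recol(1,2)[of X] X by fastforce
      qed
    qed
    moreover have "satisfies new R"
      unfolding satisfies_def
    proof (clarify)
      fix X p assume Xp: "(X, p) \<in> R"
      then have X: "X \<subseteq> E" "finite X" "p \<le> ?q X + 1" using sub fin bound by auto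
      consider "X \<in> \<D>" | "X \<notin> \<D>" "{a, b} \<subseteq> col ` X" "L \<subseteq> X" | "X \<in> \<R>"
        | "X \<notin> \<D>" "\<not> ({a, b} \<subseteq> col ` X \<and> p = ?q X)"
        using Xp by (auto simp: \<R>_def)
      then show "p \<le> int (card (new ` X))"
      proof cases
        case 1
        then have "{b1, b2} \<subseteq> X" using L(2)[of X] b12 by auto
        then have "card (new ` X) = card (col ` X \<union> {a, b})" using keep X by blast
        also have "col ` X \<union> {a, b} = insert a (col ` X)" using bD[OF 1] by auto
        finally show ?thesis using aD[OF 1] X by simp
      next
        case 2
        then have "{b1, b2} \<subseteq> X" using b12 by auto
        then have "card (new ` X) = card (col ` X \<union> {a, b})" using keep X by blast
        also have "col ` X \<union> {a, b} = col ` X" using 2 by blast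
        finally show ?thesis using bound(2)[OF Xp] 2 by simp
      next
        case 3
        then obtain r where "r \<in> P" "r \<subseteq> X" using P(4) by blast
        then have "card (new ` X) = card (col ` X \<union> {a, b})" using keep[of r X] X by blast
        also have "\<dots> = card (col ` X)" using 3 by (auto simp: \<R>_def Un_absorb2)
        moreover have "X \<notin> \<D>" using aD[of X] 3 by (auto simp: \<R>_def)
        ultimately show ?thesis using bound(2)[OF Xp] by simp
      next
        case 4
        then show ?thesis using recol(1,2)[of X] X bound(2)[OF Xp] by fastforce
      qed
    qed
    moreover have "new ` E \<subseteq> {..<k}"
      using col a(1) bk by (auto simp: new_def)
    ultimately show ?thesis by blast
  qed
qed


lemma intersecting_demands_map:
  assumes R: "intersecting_demands k E R"
    and dec: "\<And>X p. (X, p) \<in> R \<Longrightarrow> h X \<le> 0"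
    and smod: "\<And>X Y. X \<inter> Y \<noteq> {} \<Longrightarrow> h X + h Y \<le> h (X \<inter> Y) + h (X \<union> Y)"
  shows "intersecting_demands k E {(X, p + h X) |X p. (X, p) \<in> R}"
  unfolding intersecting_demands_def
proof (intro conjI ballI, goal_cases)
  case (1 z)
  then obtain X p where z: "z = (X, p + h X)" "(X, p) \<in> R" by blast
  then have "X \<subseteq> E" "p \<le> int k" "p \<le> int (card X)"
    using intersecting_demandsD[OF R] by blast+
  then show ?case using dec[OF z(2)] z(1) by simp
next
  case (2 z)
  then obtain X p where z: "z = (X, p + h X)" "(X, p) \<in> R" by blast
  have "\<exists>m n. (X \<inter> Y, m) \<in> {(X, p + h X) |X p. (X, p) \<in> R} \<and>
      (X \<union> Y, n) \<in> {(X, p + h X) |X p. (X, p) \<in> R} \<and> p + h X + (q + h Y) \<le> m + n"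
    if Y: "(Y, q) \<in> R" "X \<inter> Y \<noteq> {}" for Y q
  proof -
    from R z(2) Y obtain m n where mn: "(X \<inter> Y, m) \<in> R" "(X \<union> Y, n) \<in> R" "p + q \<le> m + n"
      by (rule intersecting_demands_supermodular)
    show ?thesis
      using mn smod[OF Y(2)]
      by (intro exI[of _ "m + h (X \<inter> Y)"] exI[of _ "n + h (X \<union> Y)"]) auto
  qed
  then show ?case using z(1) by auto
qed

text \<open>
The demands are raised by one on the sets contained in \<open>D\<close>, where \<open>D\<close> grows from the empty set to \<open>E\<close>
by one element \<open>x\<close> at a time. The intermediate demands remain supermodular
because the indicator function of \<open>X \<subseteq> D\<close> is supermodular in \<open>X\<close>, and the demands that become unmet
when \<open>x\<close> joins \<open>D\<close> all concern sets containing \<open>x\<close>.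
\<close>

lemma satisfy_one_more:
  assumes finE: "finite E" and R: "intersecting_demands k E R" and S: "intersecting_demands k E S"
    and col: "col ` E \<subseteq> {..<k}" and satS: "satisfies col S"
    and satR: "satisfies col {(X, p - 1) |X p. (X, p) \<in> R}"
  shows "\<exists>new. new ` E \<subseteq> {..<k} \<and> satisfies new S \<and> satisfies new R"
proof -
  let ?h = "\<lambda>D X. if X \<subseteq> D then 0 else - 1 :: int"
  let ?R = "\<lambda>D. {(X, p + ?h D X) |X p. (X, p) \<in> R}"
  have "\<exists>new. new ` E \<subseteq> {..<k} \<and> satisfies new S \<and> satisfies new (?R D)" if "finite D" for D
    using that
  proof (induction D rule: finite_induct)
    case empty
    have "satisfies col (?R {})"
      using satR R unfolding satisfies_def intersecting_demands_def by fastforce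
    then show ?case using col satS by blast
  next
    case (insert x D)
    then obtain new where new: "new ` E \<subseteq> {..<k}" "satisfies new S" "satisfies new (?R D)"
      by blast
    have R': "intersecting_demands k E (?R (insert x D))"
      by (rule intersecting_demands_map[OF R]) auto
    show ?case
    proof (rule repair_deficient_demands[OF finE R' S new(1,2), of x])
      fix X p assume "(X, p) \<in> ?R (insert x D)" and less: "int (card (new ` X)) < p"
      then obtain r where r: "(X, r) \<in> R" "p = r + ?h (insert x D) X" by blast
      then have "(X, r + ?h D X) \<in> ?R D" by blast
      then have le: "r + ?h D X \<le> int (card (new ` X))"
        using new(3) unfolding satisfies_def by blast
      show "p = int (card (new ` X)) + 1 \<and> x \<in> X"
        using le less r(2) by (auto split: if_splits)
    qed
  qed
  from this[OF finE] obtain new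
    where new: "new ` E \<subseteq> {..<k}" "satisfies new S" "satisfies new (?R E)" by blast
  have "R \<subseteq> ?R E"
    using R unfolding intersecting_demands_def by fastforce
  then have "satisfies new R" using new(3) unfolding satisfies_def by blast
  then show ?thesis using new by blast
qed

text \<open>
Lowering all demands of \<open>R\<close> by \<open>k\<close> makes them vacuous; they are then raised one by one.
\<close>

lemma satisfy_second_family:
  assumes finE: "finite E" and R: "intersecting_demands k E R" and S: "intersecting_demands k E S"
    and col: "col ` E \<subseteq> {..<k}" and satS: "satisfies col S"
  shows "\<exists>new. new ` E \<subseteq> {..<k} \<and> satisfies new S \<and> satisfies new R"
proof -
  let ?R = "\<lambda>n. {(X, p + (int n - int k)) |X p. (X, p) \<in> R}"
  have "\<exists>new. new ` E \<subseteq> {..<k} \<and> satisfies new S \<and> satisfies new (?R n)" if "n \<le> k" for n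
    using that
  proof (induction n)
    case 0
    have "satisfies col (?R 0)"
      using R unfolding satisfies_def intersecting_demands_def by fastforce
    then show ?case using col satS by blast
  next
    case (Suc n)
    then obtain new where new: "new ` E \<subseteq> {..<k}" "satisfies new S" "satisfies new (?R n)"
      by auto
    have R': "intersecting_demands k E (?R (Suc n))"
      by (rule intersecting_demands_map[OF R]) (use Suc.prems in auto)
    have "{(X, p - 1) |X p. (X, p) \<in> ?R (Suc n)} \<subseteq> ?R n"
      by auto
    then have "satisfies new {(X, p - 1) |X p. (X, p) \<in> ?R (Suc n)}"
      using new(3) unfolding satisfies_def by blast
    then show ?case by (rule satisfy_one_more[OF finE R' S new(1,2)])
  qed
  from this[of k] show ?thesis by simp
qed

text \<open>
Schrijver's theorem on supermodular colourings.
\<close>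

theorem supermodular_colouring:
  assumes finE: "finite E" and R: "intersecting_demands k E R" and S: "intersecting_demands k E S"
    and k: "0 < k"
  shows "\<exists>col. col ` E \<subseteq> {..<k} \<and> satisfies col R \<and> satisfies col S"
proof -
  have "intersecting_demands k E {}" "(\<lambda>_. 0) ` E \<subseteq> {..<k}" "satisfies (\<lambda>_. 0) {}"
    using k by (auto simp: intersecting_demands_def satisfies_def)
  from satisfy_second_family[OF finE R this] obtain col
    where "col ` E \<subseteq> {..<k}" "satisfies col R" by blast
  from satisfy_second_family[OF finE S R this] show ?thesis by blast
qed

section \<open>Extending a colouring from given roots\<close>

text \<open>
Tail and head maps are parameters rather than components of a digraph, since the proof redirects
arcs, reverses all of them and passes to copies. Arcs entering \<open>W\<close> are \<open>leaving A h t W\<close>.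
\<close>

definition leaving :: "'e set \<Rightarrow> ('e \<Rightarrow> 'a) \<Rightarrow> ('e \<Rightarrow> 'a) \<Rightarrow> 'a set \<Rightarrow> 'e set" where
  "leaving A t h W = {e \<in> A. t e \<in> W \<and> h e \<notin> W}"

lemma in_leaving: "e \<in> leaving A t h W \<longleftrightarrow> e \<in> A \<and> t e \<in> W \<and> h e \<notin> W"
  by (auto simp: leaving_def)

lemma finite_leaving: "finite A \<Longrightarrow> finite (leaving A t h W)"
  by (simp add: leaving_def)

lemma card_leaving_submodular:
  assumes "finite A"
  shows "card (leaving A t h (C \<inter> D)) + card (leaving A t h (C \<union> D)) \<le>
    card (leaving A t h C) + card (leaving A t h D)"
proof -
  let ?l = "leaving A t h"
  note fin = finite_leaving[OF assms]
  have "card (?l (C \<inter> D)) + card (?l (C \<union> D)) =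
      card (?l (C \<inter> D) \<union> ?l (C \<union> D)) + card (?l (C \<inter> D) \<inter> ?l (C \<union> D))"
    by (rule card_Un_Int[OF fin fin])
  also have "\<dots> \<le> card (?l C \<union> ?l D) + card (?l C \<inter> ?l D)"
    by (intro add_mono card_mono finite_UnI finite_Int fin disjI1) (auto simp: in_leaving)
  also have "\<dots> = card (?l C) + card (?l D)"
    by (rule card_Un_Int[OF fin fin, symmetric])
  finally show ?thesis .
qed

lemma Union_closed:
  assumes "finite S" "S \<noteq> {}" "S \<subseteq> \<C>" "\<And>C D. C \<in> \<C> \<Longrightarrow> D \<in> \<C> \<Longrightarrow> C \<union> D \<in> \<C>"
  shows "\<Union> S \<in> \<C>"
  using assms(1,2,3)
proof (induction S rule: finite_ne_induct)
  case (insert C S)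
  then show ?case using assms(4)[of C "\<Union> S"] by simp
qed simp

text \<open>
Colour \<open>c\<close> is already present on the members of \<open>\<C>\<close> that meet \<open>\<rho> c\<close>, and each member has enough
leaving arcs in \<open>F\<close> for the colours still missing. As in Lovasz's proof of Edmonds' disjoint
branchings theorem, one arc \<open>f\<close> at a time is coloured, with a colour \<open>c\<close> such that every member
containing the tail of \<open>f\<close> either has colour \<open>c\<close> already or is left by \<open>f\<close>; then the tail of \<open>f\<close> can
be added to \<open>\<rho> c\<close>. The number of missing colours is supermodular because it counts, for each colour,
whether a set is disjoint from \<open>\<rho> c\<close>.
\<close>

lemma extend_colouring_from_roots:
  fixes t h :: "'e \<Rightarrow> 'a" and \<rho> :: "nat \<Rightarrow> 'a set"
  assumes "finite F" and finC: "finite \<C>"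
    and un: "\<And>C D. C \<in> \<C> \<Longrightarrow> D \<in> \<C> \<Longrightarrow> C \<union> D \<in> \<C>"
    and inter: "\<And>C D. C \<in> \<C> \<Longrightarrow> D \<in> \<C> \<Longrightarrow> C \<inter> D \<noteq> {} \<Longrightarrow> C \<inter> D \<in> \<C>"
    and "\<And>C. C \<in> \<C> \<Longrightarrow> card {c. c < k \<and> C \<inter> \<rho> c = {}} \<le> card (leaving F t h C)"
  shows "\<exists>col. \<forall>C\<in>\<C>. \<forall>c<k. C \<inter> \<rho> c = {} \<longrightarrow> c \<in> col ` leaving F t h C"
  using assms(1,5)
proof (induction F arbitrary: \<rho> rule: finite_psubset_induct)
  case (psubset F)
  let ?l = "leaving F t h"
  define D where "D C = {c. c < k \<and> C \<inter> \<rho> c = {}}" for C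
  have finD: "finite (D C)" for C by (simp add: D_def)
  have DI: "c \<in> D C \<longleftrightarrow> c < k \<and> C \<inter> \<rho> c = {}" for c C by (simp add: D_def)
  note finl = finite_leaving[OF \<open>finite F\<close>, of t h]
  have le: "card (D C) \<le> card (?l C)" if "C \<in> \<C>" for C
    using psubset.prems[OF that] by (simp add: D_def)
  show ?case
  proof (cases "\<exists>C\<in>\<C>. \<exists>c<k. C \<inter> \<rho> c = {}")
    case False
    then show ?thesis by blast
  next
    case True
    then obtain C1 c where C1: "C1 \<in> \<C>" "C1 \<inter> \<rho> c = {}" and c: "c < k" by blast
    \<comment> \<open>Sets with no arc to spare that have colour \<open>c\<close> themselves, but contain a set without it.\<close>
    define bad where "bad X \<longleftrightarrow> X \<in> \<C> \<and> card (?l X) = card (D X) \<and> X \<inter> \<rho> c \<noteq> {} \<and>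
        (\<exists>C\<in>\<C>. C \<subseteq> X \<and> C \<inter> \<rho> c = {})" for X
    obtain X where X: "X = UNIV \<and> (\<forall>Y. \<not> bad Y) \<or> bad X"
        and Xmin: "\<And>Y. bad Y \<Longrightarrow> Y \<subseteq> X \<Longrightarrow> Y = X"
    proof (cases "\<exists>Y. bad Y")
      case True
      have "{Y. bad Y} \<subseteq> \<C>" by (auto simp: bad_def)
      then have "finite {Y. bad Y}" using finC by (rule finite_subset)
      moreover have "{Y. bad Y} \<noteq> {}" using True by blast
      ultimately obtain X where "X \<in> {Y. bad Y}" "\<forall>Y\<in>{Y. bad Y}. Y \<subseteq> X \<longrightarrow> X = Y"
        by (meson finite_has_minimal)
      then show thesis by (intro that[of X]) auto
    next
      case False
      then show thesis using that[of UNIV] by blast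
    qed
    define S where "S = {C \<in> \<C>. C \<subseteq> X \<and> C \<inter> \<rho> c = {}}"
    \<comment> \<open>The largest set below \<open>X\<close> without colour \<open>c\<close>; some arc leaves it but not \<open>X\<close>.\<close>
    define M where "M = \<Union> S"
    have "S \<noteq> {}" using X C1 by (auto simp: S_def bad_def)
    then have M: "M \<in> \<C>"
      unfolding M_def by (intro Union_closed) (use finC un in \<open>auto simp: S_def\<close>)
    have MX: "M \<subseteq> X" and M\<rho>: "M \<inter> \<rho> c = {}" by (auto simp: M_def S_def)
    have Mmax: "C \<subseteq> M" if "C \<in> \<C>" "C \<subseteq> X" "C \<inter> \<rho> c = {}" for C
      using that by (auto simp: M_def S_def)
    have "card (?l X) < card (?l M)"
    proof (cases "bad X")
      case True
      have "D X \<subset> D M"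
      proof
        show "D X \<subseteq> D M" using MX unfolding D_def by blast
        have "c \<in> D M" using M\<rho> c by (simp add: DI)
        moreover have "c \<notin> D X" using True by (simp add: DI bad_def)
        ultimately show "D X \<noteq> D M" by blast
      qed
      then have "card (D X) < card (D M)" using finD by (rule psubset_card_mono[rotated])
      then show ?thesis using True le[OF M] by (simp add: bad_def)
    next
      case False
      then have "?l X = {}" using X by (auto simp: in_leaving)
      moreover have "c \<in> D M" using M\<rho> c by (simp add: DI)
      then have "0 < card (D M)" using finD by (auto simp: card_gt_0_iff)
      ultimately show ?thesis using le[OF M] by simp
    qed
    then have "\<not> ?l M \<subseteq> ?l X" using card_mono[OF finl] by (meson leD)
    then obtain f where f: "f \<in> ?l M" "f \<notin> ?l X" by blast
    then have fF: "f \<in> F" and tf: "t f \<in> M" "t f \<in> X" and hf: "h f \<notin> M" "h f \<in> X"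
      using MX by (auto simp: in_leaving)
    define \<sigma> where "\<sigma> = \<rho>(c := insert (t f) (\<rho> c))"
    have interX: "C \<inter> X \<in> \<C>" if "C \<in> \<C>" "C \<inter> X \<noteq> {}" for C
      using X inter[OF that(1) _ that(2)] that by (auto simp: bad_def)
    \<comment> \<open>Uncrossing a counterexample \<open>C\<close> with \<open>X\<close> yields a smaller bad set, since \<open>f\<close> ends in \<open>X\<close> but not in \<open>C\<close>.\<close>
    have not_tight: "card (D C) < card (?l C)"
      if C: "C \<in> \<C>" "f \<in> ?l C" "C \<inter> \<rho> c \<noteq> {}" for C
    proof (rule ccontr)
      assume "\<not> card (D C) < card (?l C)"
      then have eq: "card (?l C) = card (D C)" using le[OF C(1)] by simp
      have tC: "t f \<in> C" and hC: "h f \<notin> C" using C(2) by (auto simp: in_leaving)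
      have CM: "C \<inter> M \<in> \<C>" using inter[OF C(1) M] tC tf by blast
      have "bad C"
        unfolding bad_def using C(1,3) eq CM M\<rho> by (intro conjI bexI[of _ "C \<inter> M"]) auto
      then have badX: "bad X" using X by auto
      then have XC: "X \<in> \<C>" "card (?l X) = card (D X)" "X \<inter> \<rho> c \<noteq> {}" by (auto simp: bad_def)
      have CX: "C \<inter> X \<in> \<C>" using interX[OF C(1)] tC tf by blast
      have "card (D C) + card (D X) = card (D C \<union> D X) + card (D C \<inter> D X)"
        by (rule card_Un_Int[OF finD finD])
      moreover have "card (D C \<inter> D X) \<le> card (D (C \<union> X))"
        by (rule card_mono[OF finD]) (auto simp: DI)
      moreover have sub: "D C \<union> D X \<subseteq> D (C \<inter> X)" by (auto simp: DI)
      then have "card (D C \<union> D X) \<le> card (D (C \<inter> X))" by (rule card_mono[OF finD])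
      moreover note card_leaving_submodular[OF \<open>finite F\<close>, of t h C X] le[OF CX] le[OF un[OF C(1) XC(1)]]
      ultimately have eq2: "card (?l (C \<inter> X)) = card (D (C \<inter> X))"
        "card (D C \<union> D X) = card (D (C \<inter> X))" using eq XC(2) by linarith+
      then have "D (C \<inter> X) = D C \<union> D X" using card_subset_eq[OF finD sub] by simp
      then have "c \<notin> D (C \<inter> X)" using C(3) XC(3) by (simp add: DI)
      then have "C \<inter> X \<inter> \<rho> c \<noteq> {}" using c by (simp add: DI)
      then have "bad (C \<inter> X)"
        unfolding bad_def using CX eq2 CM MX M\<rho> by (intro conjI bexI[of _ "C \<inter> M"]) auto
      then have "C \<inter> X = X" using Xmin by blast
      then show False using hf hC by blast
    qed
    have "\<exists>col. \<forall>C\<in>\<C>. \<forall>c<k. C \<inter> \<sigma> c = {} \<longrightarrow> c \<in> col ` leaving (F - {f}) t h C"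
    proof (rule psubset.IH)
      show "F - {f} \<subset> F" using fF by blast
    next
      fix C assume C: "C \<in> \<C>"
      let ?D' = "{c. c < k \<and> C \<inter> \<sigma> c = {}}"
      have sub: "?D' \<subseteq> D C" by (auto simp: DI \<sigma>_def split: if_splits)
      have l: "leaving (F - {f}) t h C = ?l C - {f}" by (auto simp: in_leaving)
      show "card ?D' \<le> card (leaving (F - {f}) t h C)"
      proof (cases "f \<in> ?l C")
        case False
        then show ?thesis using card_mono[OF finD sub] le[OF C] l by simp
      next
        case True
        have "card ?D' < card (?l C)"
        proof (cases "C \<inter> \<rho> c = {}")
          case True
          have "c \<notin> ?D'" using \<open>f \<in> ?l C\<close> by (auto simp: \<sigma>_def in_leaving)
          moreover have "c \<in> D C" using True c by (simp add: DI)
          ultimately have "?D' \<subset> D C" using sub by blast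
          then have "card ?D' < card (D C)" by (rule psubset_card_mono[OF finD])
          then show ?thesis using le[OF C] by simp
        next
          case False
          then show ?thesis using card_mono[OF finD sub] not_tight[OF C \<open>f \<in> ?l C\<close>] by simp
        qed
        then show ?thesis using l True finl by simp
      qed
    qed
    then obtain col where col: "\<And>C c. C \<in> \<C> \<Longrightarrow> c < k \<Longrightarrow> C \<inter> \<sigma> c = {} \<Longrightarrow>
        c \<in> col ` leaving (F - {f}) t h C" by blast
    have "c' \<in> (col(f := c)) ` ?l C" if C: "C \<in> \<C>" "c' < k" "C \<inter> \<rho> c' = {}" for C c'
    proof (cases "C \<inter> \<sigma> c' = {}")
      case True
      then obtain g where "g \<in> leaving (F - {f}) t h C" "c' = col g" using col[OF C(1,2)] by blast
      then have "g \<in> ?l C" "(col(f := c)) g = c'" by (auto simp: in_leaving)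
      then show ?thesis by blast
    next
      case False
      then have c': "c' = c" and tC: "t f \<in> C"
        using C(3) by (auto simp: \<sigma>_def split: if_splits)
      have "C \<inter> X \<in> \<C>" using interX[OF C(1)] tC tf by blast
      then have "C \<inter> X \<subseteq> M" using Mmax[of "C \<inter> X"] C(3) c' by blast
      then have "h f \<notin> C" using hf by blast
      then have "f \<in> ?l C" using fF tC by (simp add: in_leaving)
      moreover have "(col(f := c)) f = c'" using c' by simp
      ultimately show ?thesis by blast
    qed
    then show ?thesis by blast
  qed
qed

section \<open>Finite lattices of down-sets\<close>

text \<open>
A finite lattice \<open>L\<close> of sets that no arc enters. The assumption \<open>safe\<close> is the trace of source-sink
connectivity, and \<open>large\<close> bounds the size of all dicuts from below.
\<close>

locale dicut_lattice =
  fixes V :: "'a set" and L :: "'a set set" and A :: "'e set" and t h :: "'e \<Rightarrow> 'a" and k :: nat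
  assumes finite_lattice: "finite L" and finite_arcs: "finite A"
    and bot: "{} \<in> L" and top: "V \<in> L"
    and sub: "W \<in> L \<Longrightarrow> W \<subseteq> V"
    and inter: "U \<in> L \<Longrightarrow> W \<in> L \<Longrightarrow> U \<inter> W \<in> L"
    and union: "U \<in> L \<Longrightarrow> W \<in> L \<Longrightarrow> U \<union> W \<in> L"
    and ends: "e \<in> A \<Longrightarrow> t e \<in> V" "e \<in> A \<Longrightarrow> h e \<in> V"
    and none_enters: "e \<in> A \<Longrightarrow> W \<in> L \<Longrightarrow> h e \<in> W \<Longrightarrow> t e \<in> W"
    and safe: "X \<in> L \<Longrightarrow> U \<in> L \<Longrightarrow> Z \<in> L \<Longrightarrow> X \<noteq> {} \<Longrightarrow> U \<noteq> V \<Longrightarrow> X \<inter> Z = {} \<Longrightarrow> U \<union> Z \<noteq> V"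
    and large: "W \<in> L \<Longrightarrow> W \<noteq> {} \<Longrightarrow> W \<noteq> V \<Longrightarrow> k \<le> card (leaving A t h W)"
begin

definition full :: "('e \<Rightarrow> nat) \<Rightarrow> bool" where
  "full col \<longleftrightarrow> (\<forall>W\<in>L. W \<noteq> {} \<longrightarrow> W \<noteq> V \<longrightarrow> {..<k} \<subseteq> col ` leaving A t h W)"

text \<open>
The empty set satisfies this as well; it does no harm because no arc leaves it. The same holds for
the whole of \<open>V\<close> and \<open>coatom\<close> below.
\<close>

definition atom :: "'a set \<Rightarrow> bool" where
  "atom U \<longleftrightarrow> U \<in> L \<and> (\<forall>W\<in>L. U \<subseteq> W \<or> U \<inter> W = {})"

definition coatom :: "'a set \<Rightarrow> bool" where
  "coatom U \<longleftrightarrow> U \<in> L \<and> (\<forall>W\<in>L. W \<subseteq> U \<or> U \<union> W = V)"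

definition source_arcs :: "'e set" where
  "source_arcs = {e. \<exists>U. atom U \<and> e \<in> leaving A t h U}"

definition sink_arcs :: "'e set" where
  "sink_arcs = {e. \<exists>U. coatom U \<and> e \<in> leaving A t h U}"

text \<open>
By \<open>safe\<close>, a member of \<open>L\<close> that is not \<open>meet_safe\<close> has a proper union with every proper member,
so its complement is \<open>meet_safe\<close> in the dual lattice.
\<close>

definition meet_safe :: "'a set \<Rightarrow> bool" where
  "meet_safe Z \<longleftrightarrow> Z \<in> L \<and> (\<forall>X\<in>L. X \<noteq> {} \<longrightarrow> X \<inter> Z \<noteq> {})"

lemma source_sink_arcs_subset: "source_arcs \<subseteq> A" "sink_arcs \<subseteq> A"
  by (auto simp: source_arcs_def sink_arcs_def in_leaving)

lemma finite_source_sink_arcs: "finite source_arcs" "finite sink_arcs"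
  by (rule finite_subset[OF _ finite_arcs], rule source_sink_arcs_subset)+

lemma leaving_complement:
  assumes "F \<subseteq> A"
  shows "leaving F h t (V - W) = leaving F t h W"
  using assms ends by (auto simp: in_leaving)

lemma sublattice:
  assumes "L' \<subseteq> L" "A' \<subseteq> A" "{} \<in> L'" "V \<in> L'"
    and "\<And>U W. U \<in> L' \<Longrightarrow> W \<in> L' \<Longrightarrow> U \<inter> W \<in> L'"
    and "\<And>U W. U \<in> L' \<Longrightarrow> W \<in> L' \<Longrightarrow> U \<union> W \<in> L'"
    and "\<And>W. W \<in> L' \<Longrightarrow> W \<noteq> {} \<Longrightarrow> W \<noteq> V \<Longrightarrow> k \<le> card (leaving A' t h W)"
  shows "dicut_lattice V L' A' t h k"
proof
  show "finite L'" using assms(1) finite_lattice by (rule finite_subset)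
  show "finite A'" using assms(2) finite_arcs by (rule finite_subset)
  fix U W e
  show "{} \<in> L'" "V \<in> L'" by fact+
  show "W \<subseteq> V" if "W \<in> L'" using that sub assms(1) by blast
  show "U \<inter> W \<in> L'" "U \<union> W \<in> L'" if "U \<in> L'" "W \<in> L'" using that assms(5,6) by auto
  show "t e \<in> V" "h e \<in> V" if "e \<in> A'" using that ends assms(2) by auto
  show "t e \<in> W" if "e \<in> A'" "W \<in> L'" "h e \<in> W" using that none_enters assms(1,2) by blast
  show "k \<le> card (leaving A' t h W)" if "W \<in> L'" "W \<noteq> {}" "W \<noteq> V" using that assms(7) by simp
  show "U \<union> Z \<noteq> V"
    if "X \<in> L'" "U \<in> L'" "Z \<in> L'" "X \<noteq> {}" "U \<noteq> V" "X \<inter> Z = {}" for X U Z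
    using safe[of X U Z] that assms(1) by blast
qed

text \<open>
Reversing all arcs and complementing all sets exchanges atoms and coatoms.
\<close>

lemma dual: "dicut_lattice V ((\<lambda>W. V - W) ` L) A h t k"
proof
  show "finite ((\<lambda>W. V - W) ` L)" "finite A" using finite_lattice finite_arcs by auto
  show "{} \<in> (\<lambda>W. V - W) ` L" using top by force
  show "V \<in> (\<lambda>W. V - W) ` L" using bot by force
  show "U \<inter> W \<in> (\<lambda>W. V - W) ` L"
    if UW: "U \<in> (\<lambda>W. V - W) ` L" "W \<in> (\<lambda>W. V - W) ` L" for U W
  proof -
    obtain U' W' where "U' \<in> L" "W' \<in> L" "U = V - U'" "W = V - W'" using UW by blast
    then show ?thesis using union[of U' W'] by (intro image_eqI[of _ _ "U' \<union> W'"]) auto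
  qed
  show "U \<union> W \<in> (\<lambda>W. V - W) ` L"
    if UW: "U \<in> (\<lambda>W. V - W) ` L" "W \<in> (\<lambda>W. V - W) ` L" for U W
  proof -
    obtain U' W' where "U' \<in> L" "W' \<in> L" "U = V - U'" "W = V - W'" using UW by blast
    then show ?thesis using inter[of U' W'] by (intro image_eqI[of _ _ "U' \<inter> W'"]) auto
  qed
  show "h e \<in> V" "t e \<in> V" if "e \<in> A" for e using ends that by auto
  show "h e \<in> W" if "e \<in> A" "W \<in> (\<lambda>W. V - W) ` L" "t e \<in> W" for e W
    using that ends none_enters by auto
  show "U \<union> Z \<noteq> V"
    if *: "X \<in> (\<lambda>W. V - W) ` L" "U \<in> (\<lambda>W. V - W) ` L" "Z \<in> (\<lambda>W. V - W) ` L"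
      "X \<noteq> {}" "U \<noteq> V" "X \<inter> Z = {}" for X U Z
  proof -
    obtain X' U' Z' where L: "X' \<in> L" "U' \<in> L" "Z' \<in> L" and eq: "X = V - X'" "U = V - U'" "Z = V - Z'"
      using *(1-3) by blast
    have subs: "X' \<subseteq> V" "U' \<subseteq> V" "Z' \<subseteq> V" using sub L by auto
    have "U' \<noteq> {}" "X' \<noteq> V" "X' \<union> Z' = V" using * eq subs by auto
    then have "U' \<inter> Z' \<noteq> {}" using safe[of U' X' Z'] L by blast
    then show ?thesis using eq subs by blast
  qed
  show "k \<le> card (leaving A h t W)" if W: "W \<in> (\<lambda>W. V - W) ` L" "W \<noteq> {}" "W \<noteq> V" for W
  proof -
    obtain W' where W': "W' \<in> L" "W = V - W'" using W by blast
    then have "W' \<noteq> V" "W' \<noteq> {}" using W by auto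
    then show ?thesis using large[OF W'(1)] leaving_complement[of A W'] W'(2) by simp
  qed
qed auto

lemma meet_safe_inter: "meet_safe U \<Longrightarrow> meet_safe W \<Longrightarrow> meet_safe (U \<inter> W)"
  unfolding meet_safe_def by (metis Int_assoc inter)

lemma meet_safe_union: "meet_safe U \<Longrightarrow> W \<in> L \<Longrightarrow> meet_safe (U \<union> W)"
  unfolding meet_safe_def using union by blast

text \<open>
A set that meets every non-empty member of \<open>L\<close> contains every atom.
\<close>

lemma source_arc_tail:
  assumes "e \<in> source_arcs" "meet_safe W"
  shows "t e \<in> W"
  using assms unfolding source_arcs_def meet_safe_def atom_def in_leaving by blast

lemma Inter_closed:
  assumes "finite S" "S \<noteq> {}" "S \<subseteq> L"
  shows "\<Inter> S \<in> L"
  using assms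
proof (induction S rule: finite_ne_induct)
  case (insert C S)
  then show ?case using inter[of C "\<Inter> S"] by simp
qed simp

text \<open>
The half of the final case that concerns the \<open>meet_safe\<close> sets. Let \<open>Z\<close> be the least member of \<open>L\<close>
that contains the heads of all arcs leaving only an atom. Passing from \<open>W\<close> to \<open>W \<union> Z\<close> does not create
new leaving arcs, so only sets above \<open>Z\<close> matter, and these are left only by arcs in
\<open>source_arcs \<inter> sink_arcs\<close> and in \<open>sink_arcs - source_arcs\<close>. Whether an arc of the first kind leaves
\<open>W\<close> depends on its head alone, which turns the members of \<open>L\<close> into a family of arc sets closed under
unions and intersections. The demands \<open>R\<close> say that the first kind must supply all colours which the
second kind is too small to supply.
\<close>

lemma meet_safe_side:
  assumes cover: "A \<subseteq> source_arcs \<union> sink_arcs"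
    and apart: "\<And>e f. e \<in> source_arcs - sink_arcs \<Longrightarrow> f \<in> sink_arcs - source_arcs \<Longrightarrow>
      \<exists>W\<in>L. h e \<in> W \<and> t f \<notin> W"
  shows "\<exists>R. intersecting_demands k (source_arcs \<inter> sink_arcs) R \<and>
    (\<forall>col. col ` (source_arcs \<inter> sink_arcs) \<subseteq> {..<k} \<longrightarrow> satisfies col R \<longrightarrow>
      (\<exists>new. \<forall>W. meet_safe W \<longrightarrow> W \<noteq> V \<longrightarrow> {..<k} \<subseteq>
      col ` (leaving A t h W \<inter> source_arcs \<inter> sink_arcs) \<union>
      new ` (leaving A t h W \<inter> (sink_arcs - source_arcs))))"
proof -
  define E0 where "E0 = source_arcs \<inter> sink_arcs"
  define E1 where "E1 = source_arcs - sink_arcs"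
  define E2 where "E2 = sink_arcs - source_arcs"
  have split: "A = E0 \<union> E1 \<union> E2" and dis: "E0 \<inter> E1 = {}" "E0 \<inter> E2 = {}"
    and finE: "finite E0" "finite E2" and subA: "E0 \<subseteq> A" "E1 \<subseteq> A" "E2 \<subseteq> A"
    using cover source_sink_arcs_subset finite_source_sink_arcs by (auto simp: E0_def E1_def E2_def)
  define Z where "Z = \<Inter> {W \<in> L. h ` E1 \<subseteq> W}"
  have "h ` E1 \<subseteq> V" using subA ends by auto
  then have ZL: "Z \<in> L"
    unfolding Z_def using finite_lattice top by (intro Inter_closed) auto
  have hZ: "h e \<in> Z" if "e \<in> E1" for e using that by (auto simp: Z_def)
  have Zmin: "Z \<subseteq> W" if "W \<in> L" "h ` E1 \<subseteq> W" for W using that by (auto simp: Z_def)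
  \<comment> \<open>The largest member of \<open>L\<close> avoiding the tail of \<open>f\<close> contains all heads in question.\<close>
  have tZ: "t f \<notin> Z" if f: "f \<in> E2" for f
  proof -
    let ?S = "{W \<in> L. t f \<notin> W}"
    have "\<Union> ?S \<in> L" using finite_lattice bot union by (intro Union_closed) auto
    moreover have "h ` E1 \<subseteq> \<Union> ?S" using apart f by (auto simp: E1_def E2_def)
    ultimately have "Z \<subseteq> \<Union> ?S" by (rule Zmin)
    then show ?thesis by blast
  qed
  \<comment> \<open>A proper coatom above \<open>W\<close> contains the head of every arc that leaves an atom but no coatom.\<close>
  have proper: "W \<union> Z \<noteq> V" if W: "meet_safe W" "W \<noteq> V" for W
  proof -
    have "finite {M \<in> L. W \<subseteq> M \<and> M \<noteq> V}" "W \<in> {M \<in> L. W \<subseteq> M \<and> M \<noteq> V}"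
      using W finite_lattice by (auto simp: meet_safe_def)
    from finite_has_maximal2[OF this] obtain M
      where M: "M \<in> L" "W \<subseteq> M" "M \<noteq> V" and
        max': "\<forall>N\<in>{M \<in> L. W \<subseteq> M \<and> M \<noteq> V}. M \<subseteq> N \<longrightarrow> M = N" by blast
    have max: "M = N" if "N \<in> L" "N \<noteq> V" "M \<subseteq> N" for N
      using bspec[OF max', of N] that subset_trans[OF M(2) that(3)] by simp
    have "U \<subseteq> M \<or> M \<union> U = V" if "U \<in> L" for U
      using max[of "M \<union> U"] union[OF M(1) that] by blast
    then have "coatom M" using M(1) by (auto simp: coatom_def)
    then have "h e \<in> M" if "e \<in> E1" for e
      using that source_arc_tail[of e W] W(1) M(2) subA
      by (auto simp: E1_def sink_arcs_def in_leaving)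
    then have "Z \<subseteq> M" using Zmin[OF M(1)] by blast
    then show ?thesis using M sub[OF M(1)] by blast
  qed
  have implied: "leaving A t h (W \<union> Z) \<subseteq> leaving A t h W" if W: "meet_safe W" for W
  proof
    fix e assume "e \<in> leaving A t h (W \<union> Z)"
    then have e: "e \<in> A" "t e \<in> W \<union> Z" "h e \<notin> W" "h e \<notin> Z" by (auto simp: in_leaving)
    then have "e \<notin> E1" using hZ by blast
    then have "e \<in> E0 \<or> e \<in> E2" using e(1) split by blast
    then have "t e \<in> W"
      using e(2) source_arc_tail[OF _ W, of e] tZ[of e] by (auto simp: E0_def)
    then show "e \<in> leaving A t h W" using e by (simp add: in_leaving)
  qed
  define \<F> where "\<F> = {W. meet_safe W \<and> Z \<subseteq> W \<and> W \<noteq> V}"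
  have FL: "W \<in> L" "W \<subseteq> V" "meet_safe W" if "W \<in> \<F>" for W
    using that sub by (auto simp: \<F>_def meet_safe_def)
  have F_inter: "U \<inter> W \<in> \<F>" if "U \<in> \<F>" "W \<in> \<F>" for U W
    using that meet_safe_inter[of U W] FL(2)[of U] FL(2)[of W] by (auto simp: \<F>_def)
  have F_union: "U \<union> W \<in> \<F>" if "U \<in> \<F>" "W \<in> \<F>" "U \<union> W \<noteq> V" for U W
    using that meet_safe_union[of U W] FL(1)[of W] by (auto simp: \<F>_def)
  define X where "X W = {e \<in> E0. h e \<notin> W}" for W
  define d where "d W = card (leaving E2 t h W)" for W
  have XE: "X W \<subseteq> E0" "finite (X W)" for W using finE by (auto simp: X_def)
  have X_eq: "leaving A t h W \<inter> E0 = X W" if "W \<in> \<F>" for W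
    using source_arc_tail[OF _ FL(3)[OF that]] subA by (auto simp: X_def in_leaving E0_def)
  have E2_eq: "leaving A t h W \<inter> E2 = leaving E2 t h W" for W
    using subA by (auto simp: in_leaving)
  have count: "k \<le> card (X W) + d W" if W: "W \<in> \<F>" for W
  proof (cases "W = {}")
    case True
    have "V = {}" using FL(3)[OF W] top True by (auto simp: meet_safe_def)
    then show ?thesis using W True by (simp add: \<F>_def)
  next
    case False
    have "leaving A t h W \<inter> E1 = {}" using W hZ unfolding \<F>_def in_leaving[abs_def] leaving_def by blast
    moreover have "leaving A t h W \<subseteq> A" by (auto simp: in_leaving)
    ultimately have eq: "leaving A t h W = X W \<union> leaving E2 t h W"
      using X_eq[OF W] E2_eq[of W] split by blast
    have "X W \<inter> leaving E2 t h W = {}" using dis by (auto simp: X_def in_leaving)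
    then have "card (leaving A t h W) = card (X W) + d W"
      unfolding d_def eq by (rule card_Un_disjoint[OF XE(2) finite_leaving[OF finE(2)]])
    then show ?thesis using large[of W] FL(1)[OF W] False W by (simp add: \<F>_def)
  qed
  define R where "R = (\<lambda>W. (X W, int k - int (d W))) ` \<F>"
  have R: "intersecting_demands k E0 R"
    unfolding intersecting_demands_def
  proof (intro conjI ballI, goal_cases)
    case (1 z)
    then obtain W where W: "W \<in> \<F>" "z = (X W, int k - int (d W))" by (auto simp: R_def)
    then show ?case using count[OF W(1)] XE(1)[of W] by simp
  next
    case (2 z)
    then obtain U where U: "U \<in> \<F>" "z = (X U, int k - int (d U))" by (auto simp: R_def)
    have "\<exists>m n. (X U \<inter> X W, m) \<in> R \<and> (X U \<union> X W, n) \<in> R \<and>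
        int k - int (d U) + (int k - int (d W)) \<le> m + n"
      if W: "W \<in> \<F>" "X U \<inter> X W \<noteq> {}" for W
    proof -
      obtain e where "e \<in> E0" "h e \<notin> U \<union> W" using W(2) by (auto simp: X_def)
      then have "U \<union> W \<noteq> V" using ends subA by blast
      then have F: "U \<inter> W \<in> \<F>" "U \<union> W \<in> \<F>" using F_inter F_union U(1) W(1) by auto
      have X: "X (U \<union> W) = X U \<inter> X W" "X (U \<inter> W) = X U \<union> X W" by (auto simp: X_def)
      have "(X U \<inter> X W, int k - int (d (U \<union> W))) \<in> R" "(X U \<union> X W, int k - int (d (U \<inter> W))) \<in> R"
        using F unfolding R_def X[symmetric] by blast+
      moreover have "d (U \<inter> W) + d (U \<union> W) \<le> d U + d W"
        unfolding d_def by (rule card_leaving_submodular[OF finE(2)])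
      then have "int k - int (d U) + (int k - int (d W)) \<le>
          int k - int (d (U \<union> W)) + (int k - int (d (U \<inter> W)))" by linarith
      ultimately show ?thesis by blast
    qed
    then show ?case using U(2) by (auto simp: R_def)
  qed
  have "\<exists>new. \<forall>W. meet_safe W \<longrightarrow> W \<noteq> V \<longrightarrow>
      {..<k} \<subseteq> col ` (leaving A t h W \<inter> E0) \<union> new ` (leaving A t h W \<inter> E2)"
    if range: "col ` E0 \<subseteq> {..<k}" and col: "satisfies col R" for col
  proof -
    define \<rho> where "\<rho> c = h ` {e \<in> E0. col e = c}" for c
    \<comment> \<open>The roots of a colour are the heads of the arcs that have it already.\<close>
    have unhit: "(V - W) \<inter> \<rho> c = {} \<longleftrightarrow> c \<notin> col ` X W" for W c
    proof -
      have "h e \<in> V" if "e \<in> E0" for e using that ends subA(1) by blast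
      then show ?thesis unfolding \<rho>_def X_def by blast
    qed
    have "\<exists>new. \<forall>C\<in>(\<lambda>W. V - W) ` \<F>. \<forall>c<k. C \<inter> \<rho> c = {} \<longrightarrow> c \<in> new ` leaving E2 h t C"
    proof (rule extend_colouring_from_roots[OF finE(2)])
      have "\<F> \<subseteq> L" using FL by blast
      then show "finite ((\<lambda>W. V - W) ` \<F>)" using finite_lattice by (simp add: finite_subset)
    next
      fix C D assume "C \<in> (\<lambda>W. V - W) ` \<F>" "D \<in> (\<lambda>W. V - W) ` \<F>"
      then obtain U W where UW: "U \<in> \<F>" "W \<in> \<F>" "C = V - U" "D = V - W" by blast
      have "C \<union> D = V - (U \<inter> W)" using UW by blast
      then show "C \<union> D \<in> (\<lambda>W. V - W) ` \<F>" using F_inter UW by blast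
      assume "C \<inter> D \<noteq> {}"
      moreover have "C \<inter> D = V - (U \<union> W)" using UW by blast
      ultimately show "C \<inter> D \<in> (\<lambda>W. V - W) ` \<F>" using F_union[OF UW(1,2)] by blast
    next
      fix C assume "C \<in> (\<lambda>W. V - W) ` \<F>"
      then obtain W where W: "W \<in> \<F>" "C = V - W" by blast
      then have "(X W, int k - int (d W)) \<in> R" by (auto simp: R_def)
      then have "int k - int (d W) \<le> int (card (col ` X W))" using col by (auto simp: satisfies_def)
      moreover have "{c. c < k \<and> C \<inter> \<rho> c = {}} = {..<k} - col ` X W"
        unfolding W(2) unhit by blast
      moreover have "col ` X W \<subseteq> {..<k}" using range XE(1)[of W] by blast
      then have "card ({..<k} - col ` X W) = k - card (col ` X W)"
        using XE(2) by (simp add: card_Diff_subset)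
      ultimately show "card {c. c < k \<and> C \<inter> \<rho> c = {}} \<le> card (leaving E2 h t C)"
        unfolding W(2) leaving_complement[OF subA(3)] d_def by simp
    qed
    then obtain new where new: "\<And>W c. W \<in> \<F> \<Longrightarrow> c < k \<Longrightarrow> c \<notin> col ` X W \<Longrightarrow> c \<in> new ` leaving E2 t h W"
      unfolding ball_simps unhit leaving_complement[OF subA(3)] by blast
    have "c \<in> col ` (leaving A t h W \<inter> E0) \<union> new ` (leaving A t h W \<inter> E2)"
      if W: "meet_safe W" "W \<noteq> V" and c: "c < k" for W c
    proof -
      have WZ: "W \<union> Z \<in> \<F>"
        using meet_safe_union[OF W(1) ZL] proper[OF W] by (auto simp: \<F>_def)
      have "c \<in> col ` (leaving A t h (W \<union> Z) \<inter> E0) \<union> new ` (leaving A t h (W \<union> Z) \<inter> E2)"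
        using new[OF WZ c] X_eq[OF WZ] E2_eq by auto
      then show ?thesis using implied[OF W(1)] by blast
    qed
    then show ?thesis by blast
  qed
  then show ?thesis using R unfolding E0_def E2_def by (metis Int_assoc)
qed

lemma fullD: "full col \<Longrightarrow> W \<in> L \<Longrightarrow> W \<noteq> {} \<Longrightarrow> W \<noteq> V \<Longrightarrow> {..<k} \<subseteq> col ` leaving A t h W"
  unfolding full_def by blast

text \<open>
If \<open>U \<union> W = V\<close>, an arc leaving \<open>W\<close> ends in \<open>U\<close> and hence also starts there.
\<close>

lemma leaving_within:
  assumes "U \<in> L" "W \<subseteq> U \<or> U \<union> W = V"
  shows "leaving {e \<in> A. t e \<in> U} t h W = leaving A t h W"
proof -
  have "t e \<in> U" if "e \<in> A" "t e \<in> W" "h e \<notin> W" for e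
    using assms none_enters[OF that(1) assms(1)] ends(2)[OF that(1)] that by blast
  then show ?thesis unfolding leaving_def by blast
qed

lemma leaving_outside:
  assumes "U \<in> L" "U \<subseteq> W \<or> U \<inter> W = {}"
  shows "leaving {e \<in> A. h e \<notin> U} t h W = leaving A t h W"
proof -
  have "h e \<notin> U" if "e \<in> A" "t e \<in> W" "h e \<notin> W" for e
    using assms none_enters[OF that(1) assms(1)] that by blast
  then show ?thesis unfolding leaving_def by blast
qed

text \<open>
The final case of the finite theorem: the common arcs are coloured subject to the demands of both
sides, and the two remaining classes of arcs, each of which is relevant to one side only, are
coloured afterwards.
\<close>

lemma full_colouring_if_unmergeable:
  assumes cover: "A \<subseteq> source_arcs \<union> sink_arcs"
    and apart: "\<And>e f. e \<in> source_arcs - sink_arcs \<Longrightarrow> f \<in> sink_arcs - source_arcs \<Longrightarrow>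
      \<exists>W\<in>L. h e \<in> W \<and> t f \<notin> W"
    and "0 < k"
  shows "\<exists>col. full col"
proof -
  interpret dual: dicut_lattice V "(\<lambda>W. V - W) ` L" A h t k by (rule dual)
  have d_atom: "dual.atom (V - U) \<longleftrightarrow> coatom U" if "U \<in> L" for U
  proof -
    have "(V - U \<subseteq> V - W \<or> (V - U) \<inter> (V - W) = {}) \<longleftrightarrow> (W \<subseteq> U \<or> U \<union> W = V)" if "W \<in> L" for W
      using sub[OF that] sub[OF \<open>U \<in> L\<close>] by blast
    then show ?thesis using that by (simp add: dual.atom_def coatom_def)
  qed
  have d_coatom: "dual.coatom (V - U) \<longleftrightarrow> atom U" if "U \<in> L" for U
  proof -
    have "(V - W \<subseteq> V - U \<or> (V - U) \<union> (V - W) = V) \<longleftrightarrow> (U \<subseteq> W \<or> U \<inter> W = {})" if "W \<in> L" for W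
      using sub[OF that] sub[OF \<open>U \<in> L\<close>] by blast
    then show ?thesis using that by (simp add: dual.coatom_def atom_def)
  qed
  have d_source: "dual.source_arcs = sink_arcs"
  proof -
    have "e \<in> dual.source_arcs \<longleftrightarrow> (\<exists>U\<in>L. dual.atom (V - U) \<and> e \<in> leaving A h t (V - U))" for e
      unfolding dual.source_arcs_def by (auto simp: dual.atom_def)
    then show ?thesis
      unfolding sink_arcs_def using d_atom leaving_complement[of A] by (auto simp: coatom_def)
  qed
  have d_sink: "dual.sink_arcs = source_arcs"
  proof -
    have "e \<in> dual.sink_arcs \<longleftrightarrow> (\<exists>U\<in>L. dual.coatom (V - U) \<and> e \<in> leaving A h t (V - U))" for e
      unfolding dual.sink_arcs_def by (auto simp: dual.coatom_def)
    then show ?thesis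
      unfolding source_arcs_def using d_coatom leaving_complement[of A] by (auto simp: atom_def)
  qed
  define E0 where "E0 = source_arcs \<inter> sink_arcs"
  obtain R where R: "intersecting_demands k E0 R"
    and R_ext: "\<And>col. col ` E0 \<subseteq> {..<k} \<Longrightarrow> satisfies col R \<Longrightarrow>
      \<exists>new. \<forall>W. meet_safe W \<longrightarrow> W \<noteq> V \<longrightarrow> {..<k} \<subseteq> col ` (leaving A t h W \<inter> source_arcs \<inter> sink_arcs) \<union>
        new ` (leaving A t h W \<inter> (sink_arcs - source_arcs))"
    using meet_safe_side[OF cover apart] unfolding E0_def by blast
  have d_cover: "A \<subseteq> dual.source_arcs \<union> dual.sink_arcs"
    using cover unfolding d_source d_sink by blast
  have d_apart: "\<exists>W\<in>(\<lambda>W. V - W) ` L. t f \<in> W \<and> h e \<notin> W"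
    if ef: "f \<in> dual.source_arcs - dual.sink_arcs" "e \<in> dual.sink_arcs - dual.source_arcs" for e f
  proof -
    have ef': "e \<in> source_arcs - sink_arcs" "f \<in> sink_arcs - source_arcs"
      using ef unfolding d_source d_sink by blast+
    obtain W where "W \<in> L" "h e \<in> W" "t f \<notin> W" using apart[OF ef'] by blast
    moreover have "t f \<in> V" using ef'(2) source_sink_arcs_subset(2) ends by blast
    ultimately show ?thesis by (intro bexI[of _ "V - W"]) auto
  qed
  obtain S where S: "intersecting_demands k E0 S"
    and S_ext: "\<And>col. col ` E0 \<subseteq> {..<k} \<Longrightarrow> satisfies col S \<Longrightarrow>
      \<exists>new. \<forall>W. dual.meet_safe W \<longrightarrow> W \<noteq> V \<longrightarrow> {..<k} \<subseteq> col ` (leaving A h t W \<inter> sink_arcs \<inter> source_arcs) \<union>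
        new ` (leaving A h t W \<inter> (source_arcs - sink_arcs))"
    using dual.meet_safe_side[OF d_cover d_apart] unfolding d_source d_sink E0_def Int_commute[of sink_arcs]
    by blast
  have "finite E0" using finite_source_sink_arcs by (simp add: E0_def)
  from supermodular_colouring[OF this R S \<open>0 < k\<close>] obtain col0
    where col0: "col0 ` E0 \<subseteq> {..<k}" "satisfies col0 R" "satisfies col0 S" by blast
  obtain col2 where col2: "\<And>W. meet_safe W \<Longrightarrow> W \<noteq> V \<Longrightarrow>
      {..<k} \<subseteq> col0 ` (leaving A t h W \<inter> source_arcs \<inter> sink_arcs) \<union>
        col2 ` (leaving A t h W \<inter> (sink_arcs - source_arcs))"
    using R_ext[OF col0(1,2)] by blast
  obtain col1 where col1: "\<And>W. dual.meet_safe W \<Longrightarrow> W \<noteq> V \<Longrightarrow>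
      {..<k} \<subseteq> col0 ` (leaving A h t W \<inter> sink_arcs \<inter> source_arcs) \<union>
        col1 ` (leaving A h t W \<inter> (source_arcs - sink_arcs))"
    using S_ext[OF col0(1,3)] by blast
  define col where "col e = (if e \<in> E0 then col0 e else if e \<in> source_arcs then col1 e else col2 e)" for e
  have col_eq: "col ` (X \<inter> source_arcs \<inter> sink_arcs) = col0 ` (X \<inter> source_arcs \<inter> sink_arcs)"
    "col ` (X \<inter> (source_arcs - sink_arcs)) = col1 ` (X \<inter> (source_arcs - sink_arcs))"
    "col ` (X \<inter> (sink_arcs - source_arcs)) = col2 ` (X \<inter> (sink_arcs - source_arcs))" for X
    by (rule image_cong, auto simp: col_def E0_def)+
  have "{..<k} \<subseteq> col ` leaving A t h W" if W: "W \<in> L" "W \<noteq> {}" "W \<noteq> V" for W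
  proof (cases "meet_safe W")
    case True
    show ?thesis
      using col2[OF True W(3)] unfolding col_eq(1,3)[symmetric] by blast
  next
    case False
    then obtain X where X: "X \<in> L" "X \<noteq> {}" "X \<inter> W = {}" using W(1) by (auto simp: meet_safe_def)
    have "(V - U) \<inter> (V - W) \<noteq> {}" if U: "U \<in> L" "V - U \<noteq> {}" for U
      using safe[OF X(1) U(1) W(1) X(2) _ X(3)] U(2) sub[OF U(1)] sub[OF W(1)] by blast
    then have "dual.meet_safe (V - W)" using W(1) by (auto simp: dual.meet_safe_def)
    moreover have "V - W \<noteq> V" using W(2) sub[OF W(1)] by blast
    ultimately show ?thesis
      using col1[of "V - W"] unfolding Int_assoc Int_commute[of sink_arcs]
      unfolding Int_assoc[symmetric] col_eq(1,2)[symmetric] leaving_complement[OF subset_refl]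
      by blast
  qed
  then show ?thesis unfolding full_def by blast
qed

text \<open>
Exactly \<open>k\<close> arcs leave \<open>U\<close>, so both colourings are bijective on them and the second one can be
permuted to agree with the first. If \<open>W\<close> crosses \<open>U\<close> and misses a colour \<open>c\<close>, then the arcs of colour
\<open>c\<close> leaving \<open>W \<inter> U\<close> and \<open>W \<union> U\<close> both leave \<open>U\<close>; they are distinct because one of them ends in \<open>W\<close>
and the other does not, a contradiction.
\<close>

lemma full_colouring_by_splitting:
  assumes U: "U \<in> L" and tight: "card (leaving A t h U) = k"
    and col1: "dicut_lattice.full V {W \<in> L. W \<subseteq> U \<or> U \<union> W = V} {e \<in> A. t e \<in> U} t h k col1"
    and col2: "dicut_lattice.full V {W \<in> L. U \<subseteq> W \<or> U \<inter> W = {}} {e \<in> A. h e \<notin> U} t h k col2"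
    and lat1: "dicut_lattice V {W \<in> L. W \<subseteq> U \<or> U \<union> W = V} {e \<in> A. t e \<in> U} t h k"
    and lat2: "dicut_lattice V {W \<in> L. U \<subseteq> W \<or> U \<inter> W = {}} {e \<in> A. h e \<notin> U} t h k"
    and ne: "U \<noteq> {}" "U \<noteq> V"
  shows "\<exists>col. full col"
proof -
  let ?l = "leaving A t h"
  have l1: "leaving {e \<in> A. t e \<in> U} t h W = ?l W" if W: "W \<in> L" "W \<subseteq> U \<or> U \<union> W = V" for W
    by (rule leaving_within[OF U W(2)])
  have l2: "leaving {e \<in> A. h e \<notin> U} t h W = ?l W" if W: "W \<in> L" "U \<subseteq> W \<or> U \<inter> W = {}" for W
    by (rule leaving_outside[OF U W(2)])
  have f1: "{..<k} \<subseteq> col1 ` ?l W" if W: "W \<in> L" "W \<subseteq> U \<or> U \<union> W = V" "W \<noteq> {}" "W \<noteq> V" for W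
    using dicut_lattice.fullD[OF lat1 col1, of W] W l1[OF W(1,2)] by simp
  have f2: "{..<k} \<subseteq> col2 ` ?l W" if W: "W \<in> L" "U \<subseteq> W \<or> U \<inter> W = {}" "W \<noteq> {}" "W \<noteq> V" for W
    using dicut_lattice.fullD[OF lat2 col2, of W] W l2[OF W(1,2)] by simp
  have finU: "finite (?l U)" by (rule finite_leaving[OF finite_arcs])
  have bij: "bij_betw c (?l U) {..<k}" if "{..<k} \<subseteq> c ` ?l U" for c
  proof -
    have "card (c ` ?l U) \<le> k" using card_image_le[OF finU, of c] tight by simp
    then have eq: "c ` ?l U = {..<k}" using that finU by (intro card_seteq[symmetric]) auto
    then show ?thesis
      unfolding bij_betw_def using eq_card_imp_inj_on[OF finU, of c] tight by simp
  qed
  have b1: "bij_betw col1 (?l U) {..<k}" and b2: "bij_betw col2 (?l U) {..<k}"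
    using bij[OF f1[OF U]] bij[OF f2[OF U]] ne by auto
  \<comment> \<open>Translates the second colouring into the first.\<close>
  define \<pi> where "\<pi> = col1 \<circ> inv_into (?l U) col2"
  have \<pi>: "\<pi> ` {..<k} = {..<k}"
    using bij_betw_trans[OF bij_betw_inv_into[OF b2] b1] unfolding \<pi>_def bij_betw_def by simp
  have agree: "\<pi> (col2 e) = col1 e" if "e \<in> ?l U" for e
    using b2 that by (simp add: \<pi>_def bij_betw_def inv_into_f_f)
  define col where "col e = (if t e \<in> U then col1 e else \<pi> (col2 e))" for e
  have c2: "col e = \<pi> (col2 e)" if "e \<in> A" "h e \<notin> U" for e
    using agree[of e] that by (auto simp: col_def in_leaving)
  have sub1: "{..<k} \<subseteq> col ` ?l W" if W: "W \<in> L" "W \<subseteq> U \<or> U \<union> W = V" "W \<noteq> {}" "W \<noteq> V" for W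
  proof -
    have "t e \<in> U" if "e \<in> ?l W" for e
      using that l1[OF W(1,2)] by (auto simp: leaving_def)
    then have "col ` ?l W = col1 ` ?l W" by (intro image_cong) (auto simp: col_def)
    then show ?thesis using f1[OF W] by simp
  qed
  have sub2: "{..<k} \<subseteq> col ` ?l W" if W: "W \<in> L" "U \<subseteq> W \<or> U \<inter> W = {}" "W \<noteq> {}" "W \<noteq> V" for W
  proof -
    have "h e \<notin> U \<and> e \<in> A" if "e \<in> ?l W" for e
      using that l2[OF W(1,2)] by (auto simp: leaving_def)
    then have "col ` ?l W = \<pi> ` col2 ` ?l W" unfolding image_image by (intro image_cong) (auto simp: c2)
    then show ?thesis using image_mono[OF f2[OF W], of \<pi>] \<pi> by simp
  qed
  have inj: "inj_on col (?l U)"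
  proof -
    have "inj_on col1 (?l U)" using b1 by (simp add: bij_betw_def)
    then show ?thesis by (rule inj_on_cong[THEN iffD1, rotated]) (auto simp: col_def in_leaving)
  qed
  have "{..<k} \<subseteq> col ` ?l W" if W: "W \<in> L" "W \<noteq> {}" "W \<noteq> V" for W
  proof (cases "W \<inter> U = {} \<or> W \<union> U = V")
    case True
    then show ?thesis using sub1[OF W(1) _ W(2,3)] sub2[OF W(1) _ W(2,3)] by blast
  next
    case False
    have L: "W \<inter> U \<in> L" "W \<union> U \<in> L" using inter union W(1) U by auto
    show ?thesis
    proof
      fix c assume c: "c \<in> {..<k}"
      have "W \<inter> U \<noteq> V" using ne(2) sub[OF U] by blast
      then obtain e1 where e1: "e1 \<in> ?l (W \<inter> U)" "c = col e1"
        using sub1[OF L(1)] False c by blast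
      obtain e2 where e2: "e2 \<in> ?l (W \<union> U)" "c = col e2"
        using sub2[OF L(2)] False c W(2) by blast
      show "c \<in> col ` ?l W"
      proof (rule ccontr)
        assume no_c: "c \<notin> col ` ?l W"
        have no: "e1 \<notin> ?l W" using no_c e1(2) by (metis image_eqI)
        moreover have "e2 \<notin> ?l W" using no_c e2(2) by (metis image_eqI)
        ultimately have "e1 \<in> ?l U" "h e1 \<in> W" "e2 \<in> ?l U" "h e2 \<notin> W"
          using e1(1) e2(1) by (auto simp: in_leaving)
        then show False using inj_onD[OF inj] e1(2) e2(2) by metis
      qed
    qed
  qed
  then show ?thesis unfolding full_def by blast
qed

lemma split_lattices:
  assumes U: "U \<in> L"
  shows "dicut_lattice V {W \<in> L. W \<subseteq> U \<or> U \<union> W = V} {e \<in> A. t e \<in> U} t h k"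
    and "dicut_lattice V {W \<in> L. U \<subseteq> W \<or> U \<inter> W = {}} {e \<in> A. h e \<notin> U} t h k"
proof -
  have l1: "leaving {e \<in> A. t e \<in> U} t h W = leaving A t h W" if W: "W \<in> L" "W \<subseteq> U \<or> U \<union> W = V" for W
    by (rule leaving_within[OF U W(2)])
  have l2: "leaving {e \<in> A. h e \<notin> U} t h W = leaving A t h W" if W: "W \<in> L" "U \<subseteq> W \<or> U \<inter> W = {}" for W
    by (rule leaving_outside[OF U W(2)])
  have le: "W \<subseteq> V" if "W \<in> L" for W using sub that .
  show "dicut_lattice V {W \<in> L. W \<subseteq> U \<or> U \<union> W = V} {e \<in> A. t e \<in> U} t h k"
  proof (rule sublattice)
    fix W1 W2 assume "W1 \<in> {W \<in> L. W \<subseteq> U \<or> U \<union> W = V}" "W2 \<in> {W \<in> L. W \<subseteq> U \<or> U \<union> W = V}"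
    then show "W1 \<inter> W2 \<in> {W \<in> L. W \<subseteq> U \<or> U \<union> W = V}" "W1 \<union> W2 \<in> {W \<in> L. W \<subseteq> U \<or> U \<union> W = V}"
      using inter[of W1 W2] union[of W1 W2] le[of W1] le[of W2] le[OF U] by blast+
  next
    fix W assume "W \<in> {W \<in> L. W \<subseteq> U \<or> U \<union> W = V}" "W \<noteq> {}" "W \<noteq> V"
    then show "k \<le> card (leaving {e \<in> A. t e \<in> U} t h W)" using l1[of W] large[of W] by simp
  qed (use bot top le[OF U] in auto)
  show "dicut_lattice V {W \<in> L. U \<subseteq> W \<or> U \<inter> W = {}} {e \<in> A. h e \<notin> U} t h k"
  proof (rule sublattice)
    fix W1 W2 assume "W1 \<in> {W \<in> L. U \<subseteq> W \<or> U \<inter> W = {}}" "W2 \<in> {W \<in> L. U \<subseteq> W \<or> U \<inter> W = {}}"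
    then show "W1 \<inter> W2 \<in> {W \<in> L. U \<subseteq> W \<or> U \<inter> W = {}}" "W1 \<union> W2 \<in> {W \<in> L. U \<subseteq> W \<or> U \<inter> W = {}}"
      using inter[of W1 W2] union[of W1 W2] by blast+
  next
    fix W assume "W \<in> {W \<in> L. U \<subseteq> W \<or> U \<inter> W = {}}" "W \<noteq> {}" "W \<noteq> V"
    then show "k \<le> card (leaving {e \<in> A. h e \<notin> U} t h W)" using l2[of W] large[of W] by simp
  qed (use bot top le[OF U] in auto)
qed

text \<open>
If \<open>W\<close> were tight, it would be an atom or a coatom. As an atom it is not left by \<open>f\<close>, so it contains
the head of \<open>f\<close> and is complementary to a coatom; this contradicts \<open>safe\<close>. The other case is dual.
\<close>

lemma tight_not_between:
  assumes trivial: "\<And>U. U \<in> L \<Longrightarrow> U \<noteq> {} \<Longrightarrow> U \<noteq> V \<Longrightarrow> card (leaving A t h U) = k \<Longrightarrow> atom U \<or> coatom U"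
    and e: "e \<in> source_arcs - sink_arcs" and f: "f \<in> sink_arcs - source_arcs"
    and W: "W \<in> L" "t f \<in> W" "h e \<notin> W"
  shows "k < card (leaving A t h W)"
proof (rule ccontr)
  assume "\<not> k < card (leaving A t h W)"
  moreover have ne: "W \<noteq> {}" "W \<noteq> V" using W ends e source_sink_arcs_subset by auto
  ultimately have tight: "atom W \<or> coatom W" using trivial[OF W(1) ne] large[OF W(1) ne] by simp
  obtain U1 where U1: "atom U1" "e \<in> leaving A t h U1" using e by (auto simp: source_arcs_def)
  obtain U2 where U2: "coatom U2" "f \<in> leaving A t h U2" using f by (auto simp: sink_arcs_def)
  have L: "U1 \<in> L" "U2 \<in> L" using U1(1) U2(1) by (auto simp: atom_def coatom_def)
  from tight show False
  proof
    assume bW: "atom W"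
    then have "f \<notin> leaving A t h W" using f by (auto simp: source_arcs_def)
    then have hf: "h f \<in> W" using W(2) U2(2) by (auto simp: in_leaving)
    have "h f \<notin> U2" "h f \<in> V" using U2(2) ends by (auto simp: in_leaving)
    then have "U2 \<union> W = V" "W \<inter> U2 = {}" "U2 \<noteq> V"
      using hf U2(1) bW W(1) L(2) by (auto simp: coatom_def atom_def)
    moreover have "U2 \<noteq> {}" using U2(2) by (auto simp: in_leaving)
    ultimately show False using safe[OF L(2) L(2) W(1)] by blast
  next
    assume cW: "coatom W"
    then have "e \<notin> leaving A t h W" using e by (auto simp: sink_arcs_def)
    then have te: "t e \<notin> W" using W(3) U1(2) by (auto simp: in_leaving)
    have "t e \<in> U1" "U1 \<noteq> V" using U1(2) ends by (auto simp: in_leaving)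
    then have "U1 \<inter> W = {}" "W \<union> U1 = V"
      using te U1(1) cW W(1) L(1) by (auto simp: coatom_def atom_def)
    then show False using safe[OF L(1) L(1) W(1)] \<open>t e \<in> U1\<close> \<open>U1 \<noteq> V\<close> by (metis Un_commute empty_iff)
  qed
qed

text \<open>
A non-empty atom is contained in every member of \<open>L\<close> that sticks out of a proper coatom; otherwise this
member would be disjoint from the former and cover \<open>V\<close> together with the latter, against \<open>safe\<close>.
\<close>

lemma source_tail_below_sink_head:
  assumes e: "e \<in> source_arcs" and f: "f \<in> sink_arcs" and W: "W \<in> L" "h f \<in> W"
  shows "t e \<in> W"
proof (rule ccontr)
  assume "t e \<notin> W"
  obtain U1 where U1: "atom U1" "e \<in> leaving A t h U1" using e by (auto simp: source_arcs_def)
  obtain U2 where U2: "coatom U2" "f \<in> leaving A t h U2" using f by (auto simp: sink_arcs_def)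
  have L: "U1 \<in> L" "U2 \<in> L" using U1(1) U2(1) by (auto simp: atom_def coatom_def)
  have m: "t e \<in> U1" "h f \<notin> U2" "h f \<in> V" using U1(2) U2(2) ends by (auto simp: in_leaving)
  then have "U1 \<inter> W = {}" "U2 \<union> W = V"
    using U1(1) U2(1) W \<open>t e \<notin> W\<close> by (auto simp: atom_def coatom_def)
  then show False using safe[OF L(1) L(2) W(1)] m by blast
qed

text \<open>
The arcs \<open>e\<close> and \<open>f\<close> are replaced by one arc from the tail of \<open>e\<close> to the head of \<open>f\<close>, represented by
redirecting \<open>e\<close>. Only sets that contain the tail of \<open>f\<close> but not the head of \<open>e\<close> lose a leaving arc,
and these have one to spare by \<open>tight_not_between\<close>.
\<close>

lemma merge_lattice:
  assumes trivial: "\<And>U. U \<in> L \<Longrightarrow> U \<noteq> {} \<Longrightarrow> U \<noteq> V \<Longrightarrow> card (leaving A t h U) = k \<Longrightarrow> atom U \<or> coatom U"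
    and e: "e \<in> source_arcs - sink_arcs" and f: "f \<in> sink_arcs - source_arcs"
    and below: "\<And>W. W \<in> L \<Longrightarrow> h e \<in> W \<Longrightarrow> t f \<in> W"
  shows "dicut_lattice V L (A - {f}) t (h(e := h f)) k"
proof
  have eA: "e \<in> A" "f \<in> A" "e \<noteq> f" using e f source_sink_arcs_subset by auto
  show "finite L" "finite (A - {f})" "{} \<in> L" "V \<in> L"
    using finite_lattice finite_arcs bot top by auto
  fix U W X Z d
  show "W \<subseteq> V" if "W \<in> L" using sub that .
  show "U \<inter> W \<in> L" "U \<union> W \<in> L" if "U \<in> L" "W \<in> L" using inter union that by auto
  show "t d \<in> V" "(h(e := h f)) d \<in> V" if "d \<in> A - {f}" using that ends eA by auto
  show "t d \<in> W" if "d \<in> A - {f}" "W \<in> L" "(h(e := h f)) d \<in> W"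
    using that none_enters[of d W] source_tail_below_sink_head[of e f W] e f
    by (cases "d = e") auto
  show "U \<union> Z \<noteq> V" if "X \<in> L" "U \<in> L" "Z \<in> L" "X \<noteq> {}" "U \<noteq> V" "X \<inter> Z = {}"
    using safe that by blast
  assume W: "W \<in> L" "W \<noteq> {}" "W \<noteq> V"
  let ?new = "leaving (A - {f}) t (h(e := h f)) W" and ?old = "leaving A t h W"
  have fin: "finite ?new" "finite ?old" using finite_arcs by (auto intro: finite_leaving)
  have rest: "?new - {e} = ?old - {e, f}" by (auto simp: in_leaving)
  have fold: "f \<in> ?old \<longleftrightarrow> t f \<in> W \<and> h f \<notin> W" "e \<in> ?old \<longleftrightarrow> t e \<in> W \<and> h e \<notin> W"
    "e \<in> ?new \<longleftrightarrow> t e \<in> W \<and> h f \<notin> W"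
    using eA by (auto simp: in_leaving)
  have imp: "h f \<in> W \<Longrightarrow> t f \<in> W" "h e \<in> W \<Longrightarrow> t e \<in> W" "h e \<in> W \<Longrightarrow> t f \<in> W" "h f \<in> W \<Longrightarrow> t e \<in> W"
    using none_enters[OF eA(1) W(1)] none_enters[OF eA(2) W(1)] below[OF W(1)]
      source_tail_below_sink_head[of e f W] e f W(1) by auto
  have card_old: "card ?old = card (?old - {e, f}) + card (?old \<inter> {e, f})"
    using card_Int_Diff[OF fin(2), of "{e, f}"] by simp
  have card_new: "card ?new = card (?new - {e}) + card (?new \<inter> {e})"
    using card_Int_Diff[OF fin(1), of "{e}"] by simp
  show "k \<le> card ?new"
  proof (cases "t f \<in> W \<and> h e \<notin> W")
    case True
    have "card ?old \<le> card ?new + 1"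
    proof (cases "h f \<in> W")
      case True
      then have "?old \<inter> {e, f} \<subseteq> {e}" using fold by auto
      then have "card (?old \<inter> {e, f}) \<le> 1" using card_mono[of "{e}"] by fastforce
      then show ?thesis using card_old card_new rest by simp
    next
      case False
      show ?thesis
      proof (cases "t e \<in> W")
        case True
        then have "?new \<inter> {e} = {e}" using fold False by auto
        moreover have "card (?old \<inter> {e, f}) \<le> 2"
          using card_mono[of "{e, f}" "?old \<inter> {e, f}"] card_insert_le_m1[of 2 "{f}" e] by simp
        ultimately show ?thesis using card_old card_new rest by simp
      next
        case False
        then have "?old \<inter> {e, f} \<subseteq> {f}" using fold by auto
        then have "card (?old \<inter> {e, f}) \<le> 1" using card_mono[of "{f}"] by fastforce
        then show ?thesis using card_old card_new rest by simp
      qed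
    qed
    moreover have "k < card ?old"
      using tight_not_between[OF _ e f W(1)] trivial True by blast
    ultimately show ?thesis by simp
  next
    case False
    have "card (?old \<inter> {e, f}) \<le> card (?new \<inter> {e})"
    proof (cases "t e \<in> W \<and> h f \<notin> W")
      case True
      then have "?new \<inter> {e} = {e}" using fold by auto
      moreover have "?old \<inter> {e, f} \<subseteq> {e} \<or> ?old \<inter> {e, f} \<subseteq> {f}" using fold False by auto
      then have "card (?old \<inter> {e, f}) \<le> 1"
        using card_mono[of "{e}" "?old \<inter> {e, f}"] card_mono[of "{f}" "?old \<inter> {e, f}"] by auto
      ultimately show ?thesis by simp
    next
      case no: False
      have "e \<notin> ?old" using fold(2) imp False no by blast
      moreover have "f \<notin> ?old" using fold(1) imp False no by blast
      ultimately have "?old \<inter> {e, f} = {}" by blast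
      then show ?thesis by simp
    qed
    then show ?thesis using card_old card_new rest large[OF W] by simp
  qed
qed

end

text \<open>
In the merging step, \<open>f\<close> inherits the colour of the merged arc. Every set that the merged arc leaves
is left by \<open>e\<close> or by \<open>f\<close>, since the tail of \<open>f\<close> lies below the head of \<open>e\<close>.
\<close>

theorem full_colouring_exists:
  assumes "dicut_lattice V L A t h k"
  shows "\<exists>col. dicut_lattice.full V L A t h k col"
  using assms
proof (induction "card L + card A" arbitrary: L A h rule: less_induct)
  case less
  interpret dicut_lattice V L A t h k by (rule less.prems)
  show ?case
  proof (cases "k = 0")
    case True
    then show ?thesis unfolding full_def by simp
  next
    case False
    then have "0 < k" by simp
    show ?thesis
    proof (cases "\<exists>U\<in>L. U \<noteq> {} \<and> U \<noteq> V \<and> card (leaving A t h U) = k \<and> \<not> atom U \<and> \<not> coatom U")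
      case True
      then obtain U where U: "U \<in> L" "U \<noteq> {}" "U \<noteq> V" "card (leaving A t h U) = k"
        "\<not> atom U" "\<not> coatom U" by blast
      let ?L1 = "{W \<in> L. W \<subseteq> U \<or> U \<union> W = V}" and ?A1 = "{e \<in> A. t e \<in> U}"
      let ?L2 = "{W \<in> L. U \<subseteq> W \<or> U \<inter> W = {}}" and ?A2 = "{e \<in> A. h e \<notin> U}"
      note lat = split_lattices[OF U(1)]
      have "?L1 \<subset> L" "?L2 \<subset> L" using U(1,5,6) by (auto simp: atom_def coatom_def)
      then have "card ?L1 < card L" "card ?L2 < card L"
        using psubset_card_mono[OF finite_lattice] by auto
      moreover have "card ?A1 \<le> card A" "card ?A2 \<le> card A"
        using card_mono[OF finite_arcs] by auto
      ultimately have "card ?L1 + card ?A1 < card L + card A" "card ?L2 + card ?A2 < card L + card A"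
        by linarith+
      from less.hyps[OF this(1) lat(1)] less.hyps[OF this(2) lat(2)]
      obtain col1 col2 where "dicut_lattice.full V ?L1 ?A1 t h k col1"
        "dicut_lattice.full V ?L2 ?A2 t h k col2" by blast
      then show ?thesis by (rule full_colouring_by_splitting[OF U(1,4) _ _ lat U(2,3)])
    next
      case False
      then have trivial: "atom U \<or> coatom U"
        if "U \<in> L" "U \<noteq> {}" "U \<noteq> V" "card (leaving A t h U) = k" for U
        using that by blast
      show ?thesis
      proof (cases "A \<subseteq> source_arcs \<union> sink_arcs")
        case False
        then obtain e where e: "e \<in> A" "e \<notin> source_arcs" "e \<notin> sink_arcs" by blast
        have l: "leaving (A - {e}) t h W = leaving A t h W - {e}" for W by (auto simp: in_leaving)
        have "dicut_lattice V L (A - {e}) t h k"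
        proof (rule sublattice)
          fix W assume W: "W \<in> L" "W \<noteq> {}" "W \<noteq> V"
          show "k \<le> card (leaving (A - {e}) t h W)"
          proof (cases "e \<in> leaving A t h W")
            case True
            then have "\<not> atom W" "\<not> coatom W" using e(2,3) by (auto simp: source_arcs_def sink_arcs_def)
            then have "card (leaving A t h W) \<noteq> k" using trivial[OF W] by blast
            then have "k < card (leaving A t h W)" using large[OF W] by simp
            then show ?thesis using True finite_leaving[OF finite_arcs] unfolding l by simp
          next
            case False
            then show ?thesis using large[OF W] unfolding l by simp
          qed
        qed (use bot top inter union in auto)
        moreover have "card L + card (A - {e}) < card L + card A"
          using card_Diff1_less[OF finite_arcs e(1)] by simp
        ultimately obtain col where col: "dicut_lattice.full V L (A - {e}) t h k col"
          and lat: "dicut_lattice V L (A - {e}) t h k"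
          using less.hyps by blast
        have "full col"
          using col unfolding dicut_lattice.full_def[OF lat] full_def l
          by (meson Diff_subset image_mono subset_trans)
        then show ?thesis by blast
      next
        case cover: True
        show ?thesis
        proof (cases "\<exists>e f. e \<in> source_arcs - sink_arcs \<and> f \<in> sink_arcs - source_arcs \<and>
            (\<forall>W\<in>L. h e \<in> W \<longrightarrow> t f \<in> W)")
          case False
          then show ?thesis using full_colouring_if_unmergeable[OF cover _ \<open>0 < k\<close>] by blast
        next
          case True
          then obtain e f where ef: "e \<in> source_arcs - sink_arcs" "f \<in> sink_arcs - source_arcs"
            and below: "\<And>W. W \<in> L \<Longrightarrow> h e \<in> W \<Longrightarrow> t f \<in> W" by blast
          have eA: "e \<in> A" "f \<in> A" "e \<noteq> f" using ef source_sink_arcs_subset by auto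
          have lat: "dicut_lattice V L (A - {f}) t (h(e := h f)) k"
            using trivial ef below by (rule merge_lattice)
          moreover have "card L + card (A - {f}) < card L + card A"
            using card_Diff1_less[OF finite_arcs eA(2)] by simp
          ultimately obtain col where col: "dicut_lattice.full V L (A - {f}) t (h(e := h f)) k col"
            using less.hyps by blast
          let ?col = "col(f := col e)"
          have "c \<in> ?col ` leaving A t h W" if W: "W \<in> L" "W \<noteq> {}" "W \<noteq> V" and "c < k" for W c
          proof -
            obtain d where d: "d \<in> leaving (A - {f}) t (h(e := h f)) W" "c = col d"
              using dicut_lattice.fullD[OF lat col W] \<open>c < k\<close> by auto
            show ?thesis
            proof (cases "d = e")
              case False
              then have "d \<in> leaving A t h W" "?col d = c" using d by (auto simp: in_leaving)
              then show ?thesis by blast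
            next
              case True
              then have "t e \<in> W" "h f \<notin> W" using d(1) by (auto simp: in_leaving)
              then have "e \<in> leaving A t h W \<or> f \<in> leaving A t h W"
                using eA below[OF W(1)] by (auto simp: in_leaving)
              moreover have "?col e = c" "?col f = c" using True d(2) by auto
              ultimately show ?thesis by (metis image_eqI)
            qed
          qed
          then have "full ?col" unfolding full_def by blast
          then show ?thesis by blast
        qed
      qed
    qed
  qed
qed

section \<open>Infinitely many dicuts: compactness\<close>

text \<open>
Colourings form a compact product space, and since every \<open>B\<close> is finite, the colourings that show all
colours on \<open>B\<close> form a closed set.
\<close>

lemma finitely_many_compatible_colours:
  fixes \<F> :: "'e set set"
  assumes fin: "\<And>B. B \<in> \<F> \<Longrightarrow> finite B" and "0 < k"
    and loc: "\<And>\<G>. finite \<G> \<Longrightarrow> \<G> \<subseteq> \<F> \<Longrightarrow> \<exists>col :: 'e \<Rightarrow> nat. \<forall>B\<in>\<G>. {..<k} \<subseteq> col ` B"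
  shows "\<exists>col :: 'e \<Rightarrow> nat. \<forall>B\<in>\<F>. {..<k} \<subseteq> col ` B"
proof -
  define X where "X = product_topology (\<lambda>_ :: 'e. discrete_topology {..<k}) UNIV"
  define K where "K B = {col \<in> topspace X. {..<k} \<subseteq> col ` B}" for B
  have "compact_space X"
    unfolding X_def compact_space_product_topology by (simp add: compact_space_discrete_topology)
  then have fip: "\<Inter> \<U> \<noteq> {}"
    if "\<And>C. C \<in> \<U> \<Longrightarrow> closedin X C" "\<And>\<G>. finite \<G> \<Longrightarrow> \<G> \<subseteq> \<U> \<Longrightarrow> \<Inter> \<G> \<noteq> {}" for \<U>
    using that unfolding compact_space_fip by blast
  have "\<Inter> (insert (topspace X) (K ` \<F>)) \<noteq> {}"
  proof (rule fip)
    fix C assume "C \<in> insert (topspace X) (K ` \<F>)"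
    moreover have "closedin X (K B)" if B: "B \<in> \<F>" for B
    proof -
      have point: "closedin X {col \<in> topspace X. col e \<in> {c}}" if "c < k" for e c
      proof (rule closedin_continuous_map_preimage)
        show "continuous_map X (discrete_topology {..<k}) (\<lambda>col. col e)"
          unfolding X_def by (rule continuous_map_product_projection) simp
        show "closedin (discrete_topology {..<k}) {c}" using that by simp
      qed
      have "closedin X (\<Union>e\<in>B. {col \<in> topspace X. col e \<in> {c}})" if "c < k" for c
        using point[OF that] fin[OF B] by (intro closedin_Union) auto
      then have "closedin X (\<Inter>c\<in>{..<k}. \<Union>e\<in>B. {col \<in> topspace X. col e \<in> {c}})"
        using \<open>0 < k\<close> by (intro closedin_Inter) auto
      moreover have "(\<Inter>c\<in>{..<k}. \<Union>e\<in>B. {col \<in> topspace X. col e \<in> {c}}) = K B"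
        using \<open>0 < k\<close> unfolding K_def by auto
      ultimately show ?thesis by simp
    qed
    ultimately show "closedin X C" by auto
  next
    fix \<G> assume G: "finite \<G>" "\<G> \<subseteq> insert (topspace X) (K ` \<F>)"
    have "\<G> - {topspace X} \<subseteq> K ` \<F>" "finite (\<G> - {topspace X})" using G by auto
    then obtain \<H> where H: "\<H> \<subseteq> \<F>" "finite \<H>" "\<G> - {topspace X} = K ` \<H>"
      by (meson finite_subset_image)
    obtain col where col: "\<forall>B\<in>\<H>. {..<k} \<subseteq> col ` B" using loc[OF H(2,1)] by blast
    define col' where "col' e = (if col e < k then col e else 0)" for e :: 'e
    have "col' \<in> topspace X" using \<open>0 < k\<close> by (auto simp: X_def col'_def PiE_def extensional_def)
    moreover have "{..<k} \<subseteq> col' ` B" if "B \<in> \<H>" for B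
    proof
      fix c assume c: "c \<in> {..<k}"
      then have "c \<in> col ` B" using bspec[OF col that] by (rule subsetD[rotated])
      then obtain e where "e \<in> B" "col e = c" by auto
      then have "e \<in> B" "col' e = c" using c by (auto simp: col'_def)
      then show "c \<in> col' ` B" by blast
    qed
    ultimately have "col' \<in> Z" if "Z \<in> insert (topspace X) (K ` \<H>)" for Z
      using that unfolding K_def by auto
    moreover have "\<G> \<subseteq> insert (topspace X) (K ` \<H>)" unfolding H(3)[symmetric] by blast
    ultimately have "col' \<in> \<Inter> \<G>" by (meson InterI subsetD)
    then show "\<Inter> \<G> \<noteq> {}" by blast
  qed
  then obtain col where "col \<in> \<Inter> (insert (topspace X) (K ` \<F>))" by (meson ex_in_conv)
  then have K: "col \<in> K B" if "B \<in> \<F>" for B using that by (meson InterD imageI insertI2)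
  have "\<forall>B\<in>\<F>. {..<k} \<subseteq> col ` B"
  proof
    fix B assume "B \<in> \<F>"
    from K[OF this] show "{..<k} \<subseteq> col ` B" unfolding K_def by blast
  qed
  then show ?thesis by (intro exI[of _ col])
qed

text \<open>
Finitely many members of \<open>L\<close> partition \<open>V\<close> into finitely many classes, according to which of them
contain a given point. The members of \<open>L\<close> that are unions of classes form a finite lattice, and every
arc leaving one of them already leaves one of the given members.
\<close>

lemma infinite_full_colouring:
  fixes V :: "'a set" and L :: "'a set set" and A :: "'e set" and t h :: "'e \<Rightarrow> 'a"
  assumes bot: "{} \<in> L" and top: "V \<in> L"
    and sub: "\<And>W. W \<in> L \<Longrightarrow> W \<subseteq> V"
    and inter: "\<And>U W. U \<in> L \<Longrightarrow> W \<in> L \<Longrightarrow> U \<inter> W \<in> L"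
    and union: "\<And>U W. U \<in> L \<Longrightarrow> W \<in> L \<Longrightarrow> U \<union> W \<in> L"
    and ends: "\<And>e. e \<in> A \<Longrightarrow> t e \<in> V" "\<And>e. e \<in> A \<Longrightarrow> h e \<in> V"
    and none_enters: "\<And>e W. e \<in> A \<Longrightarrow> W \<in> L \<Longrightarrow> h e \<in> W \<Longrightarrow> t e \<in> W"
    and safe: "\<And>X U Z. X \<in> L \<Longrightarrow> U \<in> L \<Longrightarrow> Z \<in> L \<Longrightarrow> X \<noteq> {} \<Longrightarrow> U \<noteq> V \<Longrightarrow> X \<inter> Z = {} \<Longrightarrow> U \<union> Z \<noteq> V"
    and large: "\<And>W. W \<in> L \<Longrightarrow> W \<noteq> {} \<Longrightarrow> W \<noteq> V \<Longrightarrow> finite (leaving A t h W) \<Longrightarrow> k \<le> card (leaving A t h W)"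
  shows "\<exists>col. \<forall>W\<in>L. W \<noteq> {} \<longrightarrow> W \<noteq> V \<longrightarrow> finite (leaving A t h W) \<longrightarrow> {..<k} \<subseteq> col ` leaving A t h W"
proof (cases "k = 0")
  case True
  then show ?thesis by simp
next
  case False
  let ?l = "leaving A t h"
  define \<B> where "\<B> = {W \<in> L. W \<noteq> {} \<and> W \<noteq> V \<and> finite (?l W)}"
  have "\<exists>col. \<forall>B\<in>?l ` \<B>. {..<k} \<subseteq> col ` B"
  proof (rule finitely_many_compatible_colours)
    show "finite B" if "B \<in> ?l ` \<B>" for B using that by (auto simp: \<B>_def)
    show "0 < k" using False by simp
    fix \<G> assume "finite \<G>" "\<G> \<subseteq> ?l ` \<B>"
    then obtain \<F> where F: "\<F> \<subseteq> \<B>" "finite \<F>" "\<G> = ?l ` \<F>" by (meson finite_subset_image)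
    define sig where "sig x = {U \<in> \<F>. x \<in> U}" for x
    define L' where "L' = {W \<in> L. \<forall>x\<in>V. \<forall>y\<in>V. sig x = sig y \<longrightarrow> (x \<in> W \<longleftrightarrow> y \<in> W)}"
    define A' where "A' = (\<Union>U\<in>\<F>. ?l U)"
    have A': "A' \<subseteq> A" "finite A'" using F by (auto simp: A'_def in_leaving \<B>_def)
    have L': "L' \<subseteq> L" by (auto simp: L'_def)
    have L'_sig: "x \<in> W \<longleftrightarrow> y \<in> W" if "W \<in> L'" "x \<in> V" "y \<in> V" "sig x = sig y" for W x y
      using that unfolding L'_def by blast
    have "finite L'"
    proof (rule finite_imageD)
      have "(\<lambda>W. sig ` W) ` L' \<subseteq> Pow (Pow \<F>)" by (auto simp: sig_def)
      then show "finite ((\<lambda>W. sig ` W) ` L')" using F(2) by (simp add: finite_subset)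
      have "W = {x \<in> V. sig x \<in> sig ` W}" if "W \<in> L'" for W
        using that sub unfolding L'_def by blast
      then show "inj_on (\<lambda>W. sig ` W) L'" by (intro inj_onI) metis
    qed
    have same: "leaving A' t h W = ?l W" if W: "W \<in> L'" for W
    proof -
      have "e \<in> A'" if e: "e \<in> ?l W" for e
      proof -
        have eA: "e \<in> A" "t e \<in> W" "h e \<notin> W" using e by (auto simp: in_leaving)
        then have "sig (t e) \<noteq> sig (h e)" using L'_sig[OF W ends[OF eA(1)]] by blast
        then obtain U where "U \<in> \<F>" "(t e \<in> U) \<noteq> (h e \<in> U)" by (auto simp: sig_def)
        moreover have "U \<in> L" using \<open>U \<in> \<F>\<close> F(1) by (auto simp: \<B>_def)
        ultimately have "e \<in> ?l U" using none_enters[OF eA(1), of U] eA(1) by (auto simp: in_leaving)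
        then show ?thesis using \<open>U \<in> \<F>\<close> by (auto simp: A'_def)
      qed
      then show ?thesis using A'(1) by (auto simp: in_leaving)
    qed
    have lat: "dicut_lattice V L' A' t h k"
    proof
      show "finite L'" "finite A'" by fact+
      show "{} \<in> L'" "V \<in> L'" using bot top by (auto simp: L'_def)
      fix U W X Z e
      show "W \<subseteq> V" if "W \<in> L'" using that sub L' by blast
      show "U \<inter> W \<in> L'" if "U \<in> L'" "W \<in> L'"
        using inter[of U W] L' L'_sig[OF that(1)] L'_sig[OF that(2)] that
        unfolding L'_def mem_Collect_eq by (intro conjI ballI impI) (blast, metis Int_iff)
      show "U \<union> W \<in> L'" if "U \<in> L'" "W \<in> L'"
        using union[of U W] L' L'_sig[OF that(1)] L'_sig[OF that(2)] that
        unfolding L'_def mem_Collect_eq by (intro conjI ballI impI) (blast, metis Un_iff)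
      show "t e \<in> V" "h e \<in> V" if "e \<in> A'" using that A'(1) ends by auto
      show "t e \<in> W" if "e \<in> A'" "W \<in> L'" "h e \<in> W" using none_enters[of e W] that A'(1) L' by blast
      show "U \<union> Z \<noteq> V" if "X \<in> L'" "U \<in> L'" "Z \<in> L'" "X \<noteq> {}" "U \<noteq> V" "X \<inter> Z = {}"
        using safe[of X U Z] that L' by blast
      assume W: "W \<in> L'" "W \<noteq> {}" "W \<noteq> V"
      have "finite (?l W)" using same[OF W(1)] finite_leaving[OF A'(2), of t h W] by simp
      then show "k \<le> card (leaving A' t h W)" using large[of W] W L' same by auto
    qed
    from full_colouring_exists[OF this] obtain col where col: "dicut_lattice.full V L' A' t h k col"
      by blast
    have "{..<k} \<subseteq> col ` ?l U" if "U \<in> \<F>" for U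
    proof -
      have U: "U \<in> L'" "U \<noteq> {}" "U \<noteq> V" using that F(1) by (auto simp: L'_def sig_def \<B>_def)
      show ?thesis using dicut_lattice.fullD[OF lat col U] same[OF U(1)] by simp
    qed
    then show "\<exists>col. \<forall>B\<in>\<G>. {..<k} \<subseteq> col ` B" using F(3) by blast
  qed
  then show ?thesis unfolding \<B>_def by blast
qed

section \<open>Source-sink connected digraphs\<close>

text \<open>
If no point reachable from \<open>x0\<close> is reachable from all its successors, one can always walk towards a
point from which there is no return. Let \<open>f x\<close> be the distance from \<open>x\<close> to such a point. Along a walk
that decreases \<open>f\<close> as long as return is possible, no point is visited twice: between two visits
return would be possible throughout, and \<open>f\<close> would decrease.
\<close>

lemma terminal_or_ray:
  fixes r :: "'a rel"
  obtains (terminal) x where "(x0, x) \<in> r\<^sup>*" "\<And>y. (x, y) \<in> r\<^sup>* \<Longrightarrow> (y, x) \<in> r\<^sup>*"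
  | (ray) v :: "nat \<Rightarrow> 'a" where "inj v" "(x0, v 0) \<in> r\<^sup>*" "\<And>i. (v i, v (Suc i)) \<in> r"
proof (cases "\<exists>x. (x0, x) \<in> r\<^sup>* \<and> (\<forall>y. (x, y) \<in> r\<^sup>* \<longrightarrow> (y, x) \<in> r\<^sup>*)")
  case True
  then show thesis using terminal by blast
next
  case False
  define f where "f x = (LEAST n. \<exists>z. (x, z) \<in> r ^^ n \<and> (z, x) \<notin> r\<^sup>*)" for x
  have step: "\<exists>y. (x0, y) \<in> r\<^sup>* \<and> (x, y) \<in> r \<and> ((y, x) \<in> r\<^sup>* \<longrightarrow> f y < f x)"
    if x: "(x0, x) \<in> r\<^sup>*" for x
  proof -
    have "\<exists>n z. (x, z) \<in> r ^^ n \<and> (z, x) \<notin> r\<^sup>*"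
      using False x by (meson rtrancl_imp_relpow)
    then have "\<exists>z. (x, z) \<in> r ^^ f x \<and> (z, x) \<notin> r\<^sup>*"
      unfolding f_def by (rule LeastI_ex)
    then obtain z where z: "(x, z) \<in> r ^^ f x" "(z, x) \<notin> r\<^sup>*" by blast
    then obtain m where m: "f x = Suc m" by (cases "f x") auto
    then obtain y where y: "(x, y) \<in> r" "(y, z) \<in> r ^^ m" using z(1) by (metis relpow_Suc_E2)
    have "f y < f x" if "(y, x) \<in> r\<^sup>*"
    proof -
      have "(z, y) \<notin> r\<^sup>*" using z(2) that by (meson rtrancl_trans)
      then have "f y \<le> m" unfolding f_def using y(2) by (intro Least_le) blast
      then show ?thesis using m by simp
    qed
    then show ?thesis using y(1) x by (meson rtrancl.rtrancl_into_rtrancl)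
  qed
  obtain v where v: "\<And>n. (x0, v n) \<in> r\<^sup>*"
    "\<And>n. (v n, v (Suc n)) \<in> r \<and> ((v (Suc n), v n) \<in> r\<^sup>* \<longrightarrow> f (v (Suc n)) < f (v n))"
    using dependent_nat_choice[of "\<lambda>_ x. (x0, x) \<in> r\<^sup>*"
        "\<lambda>_ x y. (x, y) \<in> r \<and> ((y, x) \<in> r\<^sup>* \<longrightarrow> f y < f x)"] step by blast
  have reach: "(v i, v (i + d)) \<in> r\<^sup>*" for i d
    by (induction d) (use v(2) in \<open>auto intro: rtrancl.rtrancl_into_rtrancl\<close>)
  have "v i \<noteq> v j" if "i < j" for i j
  proof
    assume eq: "v i = v j"
    have "f (v (i + d)) + d \<le> f (v i)" if "i + d \<le> j" for d
      using that
    proof (induction d)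
      case (Suc d)
      have "(v (Suc (i + d)), v j) \<in> r\<^sup>*"
        using reach[of "Suc (i + d)" "j - Suc (i + d)"] Suc.prems by simp
      moreover have "(v j, v (i + d)) \<in> r\<^sup>*" using reach[of i d] eq by simp
      ultimately have "f (v (Suc (i + d))) < f (v (i + d))" using v(2) by (meson rtrancl_trans)
      then show ?case using Suc by simp
    qed simp
    from this[of "j - i"] show False using that eq by simp
  qed
  then have "inj v" by (metis linorder_injI)
  then show thesis using ray v by blast
qed

definition down_sets :: "('a, 'b) pre_digraph \<Rightarrow> 'a set set" where
  "down_sets D = {W. W \<subseteq> verts D \<and> (\<forall>e\<in>arcs D. head D e \<in> W \<longrightarrow> tail D e \<in> W)}"

lemma down_set_reachable:
  assumes "W \<in> down_sets D" "(x, y) \<in> (arcs_ends D)\<^sup>*" "y \<in> W"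
  shows "x \<in> W"
  using assms(2,3)
proof (induction rule: converse_rtrancl_induct)
  case (step x z)
  then obtain e where "e \<in> arcs D" "tail D e = x" "head D e = z" by auto
  then show ?case using step assms(1) by (auto simp: down_sets_def)
qed simp

context wf_digraph
begin

lemma down_set_contains_source:
  assumes W: "W \<in> down_sets G" "W \<noteq> {}"
  shows "\<exists>S\<in>source_vsets G. S \<subseteq> W"
proof -
  obtain x0 where x0: "x0 \<in> W" "x0 \<in> verts G" using W by (auto simp: down_sets_def)
  show ?thesis
  proof (cases x0 "(arcs_ends G)\<inverse>" rule: terminal_or_ray)
    case (terminal x)
    have "(x, x0) \<in> (arcs_ends G)\<^sup>*" using terminal(1) by (simp add: rtrancl_converse)
    then have xW: "x \<in> W" using down_set_reachable[OF W(1) _ x0(1)] by simp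
    then have xG: "x \<in> verts G" using W(1) by (auto simp: down_sets_def)
    have ret: "x \<rightarrow>\<^sup>* y" if "y \<rightarrow>\<^sup>* x" for y
      using terminal(2)[of y] that by (auto simp: rtrancl_converse reachable_conv)
    let ?S = "scc_of x"
    have "G \<restriction> ?S \<in> sccs" using in_verts_sccsD_sccs[OF scc_of_in_sccs_verts[OF xG]] .
    moreover have "tail G e \<in> ?S" if e: "e \<in> arcs G" "head G e \<in> ?S" for e
    proof -
      have "tail G e \<rightarrow> head G e" using e(1) by (auto simp: arcs_ends_conv)
      then have "tail G e \<rightarrow>\<^sup>* x" using e(2) by (auto simp: scc_of_def intro: adj_reachable_trans)
      then show ?thesis using ret by (simp add: scc_of_def)
    qed
    ultimately have "source_component G (G \<restriction> ?S)" by (auto simp: source_component_def)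
    then have "?S \<in> source_vsets G" unfolding source_vsets_def by force
    moreover have "?S \<subseteq> W"
      using down_set_reachable[OF W(1) _ xW] by (auto simp: scc_of_def reachable_conv)
    ultimately show ?thesis by blast
  next
    case (ray v)
    have "\<exists>e. e \<in> arcs G \<and> tail G e = v (Suc i) \<and> head G e = v i" for i
      using ray(3)[of i] by (auto simp: arcs_ends_conv)
    then obtain e where "\<And>i. e i \<in> arcs G \<and> tail G (e i) = v (Suc i) \<and> head G (e i) = v i" by metis
    then have "back_ray G v e" using ray(1) by (auto simp: back_ray_def)
    then have "range v \<in> source_vsets G" unfolding source_vsets_def by blast
    moreover have "v i \<in> W" for i
    proof (induction i)
      case 0
      have "(v 0, x0) \<in> (arcs_ends G)\<^sup>*" using ray(2) by (simp add: rtrancl_converse)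
      then show ?case using down_set_reachable[OF W(1) _ x0(1)] by simp
    next
      case (Suc i)
      then show ?case using ray(3)[of i] down_set_reachable[OF W(1), of "v (Suc i)" "v i"] by auto
    qed
    then have "range v \<subseteq> W" by blast
    ultimately show ?thesis by blast
  qed
qed

lemma down_set_avoids_sink:
  assumes W: "W \<in> down_sets G" "W \<noteq> verts G"
  shows "\<exists>T\<in>sink_vsets G. T \<subseteq> verts G - W"
proof -
  obtain x0 where x0: "x0 \<notin> W" "x0 \<in> verts G" using W by (auto simp: down_sets_def)
  have up: "y \<in> verts G - W" if "(x, y) \<in> (arcs_ends G)\<^sup>*" "x \<in> verts G - W" for x y
    using that down_set_reachable[OF W(1) that(1)] reachable_conv'[of x y] reachable_in_verts by blast
  show ?thesis
  proof (cases x0 "arcs_ends G" rule: terminal_or_ray)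
    case (terminal x)
    have xW: "x \<in> verts G - W" using up[OF terminal(1)] x0 by blast
    have ret: "y \<rightarrow>\<^sup>* x" if "x \<rightarrow>\<^sup>* y" for y
      using terminal(2)[of y] that by (auto simp: reachable_conv)
    let ?S = "scc_of x"
    have "G \<restriction> ?S \<in> sccs" using in_verts_sccsD_sccs scc_of_in_sccs_verts xW by blast
    moreover have "head G e \<in> ?S" if e: "e \<in> arcs G" "tail G e \<in> ?S" for e
    proof -
      have "tail G e \<rightarrow> head G e" using e(1) by (auto simp: arcs_ends_conv)
      then have "x \<rightarrow>\<^sup>* head G e" using e(2) by (auto simp: scc_of_def intro: reachable_adj_trans)
      then show ?thesis using ret by (simp add: scc_of_def)
    qed
    ultimately have "sink_component G (G \<restriction> ?S)" by (auto simp: sink_component_def)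
    then have "?S \<in> sink_vsets G" unfolding sink_vsets_def by force
    moreover have "?S \<subseteq> verts G - W"
      using up[OF _ xW] unfolding scc_of_def reachable_conv by blast
    ultimately show ?thesis by blast
  next
    case (ray v)
    have "\<exists>e. e \<in> arcs G \<and> tail G e = v i \<and> head G e = v (Suc i)" for i
      using ray(3)[of i] by (auto simp: arcs_ends_conv)
    then obtain e where "\<And>i. e i \<in> arcs G \<and> tail G (e i) = v i \<and> head G (e i) = v (Suc i)" by metis
    then have "out_ray G v e" using ray(1) by (auto simp: out_ray_def)
    then have "range v \<in> sink_vsets G" unfolding sink_vsets_def by blast
    moreover have "v i \<in> verts G - W" for i
    proof (induction i)
      case 0
      show ?case using up[OF ray(2)] x0 by blast
    next
      case (Suc i)
      then show ?case using up[of "v i" "v (Suc i)"] ray(3)[of i] by blast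
    qed
    then have "range v \<subseteq> verts G - W" by blast
    ultimately show ?thesis by blast
  qed
qed

text \<open>
A directed path from a source component or back-ray in \<open>X\<close> to a sink component or out-ray outside \<open>U\<close>
would have its end in \<open>Z\<close>, hence also its start.
\<close>

lemma source_sink_connected_safe:
  assumes ssc: "source_sink_connected G"
    and X: "X \<in> down_sets G" "X \<noteq> {}" and U: "U \<in> down_sets G" "U \<noteq> verts G"
    and Z: "Z \<in> down_sets G" "X \<inter> Z = {}"
  shows "U \<union> Z \<noteq> verts G"
proof
  assume cov: "U \<union> Z = verts G"
  obtain S where S: "S \<in> source_vsets G" "S \<subseteq> X" using down_set_contains_source[OF X] by blast
  obtain T where T: "T \<in> sink_vsets G" "T \<subseteq> verts G - U" using down_set_avoids_sink[OF U] by blast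
  obtain s u p where su: "s \<in> S" "u \<in> T" "apath s p u"
    using ssc S(1) T(1) unfolding source_sink_connected_def by blast
  then have "s \<rightarrow>\<^sup>* u" using reachable_apath by blast
  then have "(s, u) \<in> (arcs_ends G)\<^sup>*" by (simp add: reachable_conv)
  moreover have "u \<in> Z" using su(2) T(2) cov by blast
  ultimately have "s \<in> Z" using down_set_reachable[OF Z(1)] by blast
  then show False using su(1) S(2) Z(2) by blast
qed

text \<open>
The map \<open>\<iota>\<close> allows several copies of an edge, or none, to be coloured.
\<close>

lemma dicut_colouring:
  fixes A :: "'e set" and \<iota> :: "'e \<Rightarrow> 'b"
  assumes ssc: "source_sink_connected G" and \<iota>: "\<iota> ` A \<subseteq> arcs G"
    and large: "\<And>W. W \<in> down_sets G \<Longrightarrow> W \<noteq> {} \<Longrightarrow> W \<noteq> verts G \<Longrightarrow>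
      finite (leaving A (tail G \<circ> \<iota>) (head G \<circ> \<iota>) W) \<Longrightarrow> k \<le> card (leaving A (tail G \<circ> \<iota>) (head G \<circ> \<iota>) W)"
  shows "\<exists>col. \<forall>W\<in>down_sets G. W \<noteq> {} \<longrightarrow> W \<noteq> verts G \<longrightarrow>
      finite (leaving A (tail G \<circ> \<iota>) (head G \<circ> \<iota>) W) \<longrightarrow>
      {..<k} \<subseteq> col ` leaving A (tail G \<circ> \<iota>) (head G \<circ> \<iota>) W"
proof (rule infinite_full_colouring)
  show "{} \<in> down_sets G" "verts G \<in> down_sets G" by (auto simp: down_sets_def)
  fix U W X Z e
  show "W \<subseteq> verts G" if "W \<in> down_sets G" using that by (simp add: down_sets_def)
  show "U \<inter> W \<in> down_sets G" "U \<union> W \<in> down_sets G" if "U \<in> down_sets G" "W \<in> down_sets G"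
    using that by (auto simp: down_sets_def)
  show "(tail G \<circ> \<iota>) e \<in> verts G" "(head G \<circ> \<iota>) e \<in> verts G" if "e \<in> A" using that \<iota> by auto
  show "(tail G \<circ> \<iota>) e \<in> W" if "e \<in> A" "W \<in> down_sets G" "(head G \<circ> \<iota>) e \<in> W"
    using that \<iota> by (auto simp: down_sets_def)
  show "U \<union> Z \<noteq> verts G"
    if "X \<in> down_sets G" "U \<in> down_sets G" "Z \<in> down_sets G" "X \<noteq> {}" "U \<noteq> verts G" "X \<inter> Z = {}"
    by (rule source_sink_connected_safe[OF ssc that(1,4) that(2,5) that(3,6)])
qed (rule large)

lemma dicut_iff_leaving:
  "dicut G B \<longleftrightarrow> (\<exists>W\<in>down_sets G. W \<noteq> {} \<and> W \<noteq> verts G \<and> B = leaving (arcs G) (tail G) (head G) W)"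
proof
  assume "dicut G B"
  then obtain X Y where XY: "cut_sides G X Y" "B = edges_between G X Y"
    and heads: "(\<forall>e\<in>B. head G e \<in> X) \<or> (\<forall>e\<in>B. head G e \<in> Y)" by (auto simp: dicut_def)
  have main: "\<exists>W\<in>down_sets G. W \<noteq> {} \<and> W \<noteq> verts G \<and> B = leaving (arcs G) (tail G) (head G) W"
    if "cut_sides G X Y" "B = edges_between G X Y" "\<forall>e\<in>B. head G e \<in> X" for X Y
  proof (intro bexI conjI)
    have "tail G e \<in> Y" if e: "e \<in> arcs G" "head G e \<in> Y" for e
    proof (rule ccontr)
      assume "tail G e \<notin> Y"
      then have "tail G e \<in> X" using e(1) \<open>cut_sides G X Y\<close> tail_in_verts[OF e(1)]
        unfolding cut_sides_def by blast
      then have "head G e \<in> X"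
        using e \<open>\<forall>e\<in>B. head G e \<in> X\<close> \<open>B = edges_between G X Y\<close> by (auto simp: edges_between_def)
      then show False using e(2) \<open>cut_sides G X Y\<close> by (auto simp: cut_sides_def)
    qed
    then show "Y \<in> down_sets G"
      using that(1) by (auto simp: down_sets_def cut_sides_def)
    show "Y \<noteq> {}" "Y \<noteq> verts G" using that(1) by (auto simp: cut_sides_def)
    show "B = leaving (arcs G) (tail G) (head G) Y"
      using that by (auto simp: leaving_def cut_sides_def edges_between_def)
  qed
  have "cut_sides G Y X" "B = edges_between G Y X"
    using XY by (auto simp: cut_sides_def edges_between_def)
  then show "\<exists>W\<in>down_sets G. W \<noteq> {} \<and> W \<noteq> verts G \<and> B = leaving (arcs G) (tail G) (head G) W"
    using main[OF XY] main[of Y X] heads by blast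
next
  assume "\<exists>W\<in>down_sets G. W \<noteq> {} \<and> W \<noteq> verts G \<and> B = leaving (arcs G) (tail G) (head G) W"
  then obtain W where W: "W \<in> down_sets G" "W \<noteq> {}" "W \<noteq> verts G"
    "B = leaving (arcs G) (tail G) (head G) W" by blast
  have "cut_sides G W (verts G - W)" using W by (auto simp: cut_sides_def down_sets_def)
  moreover have "B = edges_between G W (verts G - W)"
    using W by (auto simp: leaving_def edges_between_def down_sets_def)
  moreover have "\<forall>e\<in>B. head G e \<in> verts G - W" using W(4) by (auto simp: leaving_def)
  ultimately show "dicut G B" unfolding dicut_def by blast
qed

end

section \<open>Minimum dicuts and maximum packings of dijoins\<close>

lemma card_le_imp_ordLeq:
  assumes "finite A" "finite B" "card A \<le> card B"
  shows "|A| \<le>o |B|"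
proof -
  obtain f where "f ` A \<subseteq> B" "inj_on f A" using card_le_inj[OF assms] by blast
  then show ?thesis by (intro card_of_ordLeqI[of f]) auto
qed

lemma card_eq_imp_ordIso:
  assumes "finite A" "finite B" "card A = card B"
  shows "|A| =o |B|"
  using finite_same_card_bij[OF assms] card_of_ordIsoI by blast

lemma (in wf_digraph) woodall_finite_dicuts:
  assumes ssc: "source_sink_connected G" and ne: "{B. dicut G B \<and> finite B} \<noteq> {}"
  shows "woodall G {B. dicut G B \<and> finite B}"
proof -
  let ?\<BB> = "{B. dicut G B \<and> finite B}" and ?l = "leaving (arcs G) (tail G) (head G)"
  obtain B where B: "B \<in> ?\<BB>" and min: "\<And>B'. B' \<in> ?\<BB> \<Longrightarrow> card B \<le> card B'"
    using ex_has_least_nat[of "\<lambda>B. B \<in> ?\<BB>" _ card] ne by blast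
  have "\<exists>col. \<forall>W\<in>down_sets G. W \<noteq> {} \<longrightarrow> W \<noteq> verts G \<longrightarrow> finite (?l W) \<longrightarrow>
      {..<card B} \<subseteq> col ` ?l W"
  proof (rule dicut_colouring[OF ssc, of id "arcs G", unfolded comp_id])
    show "id ` arcs G \<subseteq> arcs G" by simp
    fix W assume "W \<in> down_sets G" "W \<noteq> {}" "W \<noteq> verts G" "finite (?l W)"
    then have "?l W \<in> ?\<BB>" using dicut_iff_leaving by blast
    then show "card B \<le> card (?l W)" by (rule min)
  qed
  then obtain col where col: "\<forall>W\<in>down_sets G. W \<noteq> {} \<longrightarrow> W \<noteq> verts G \<longrightarrow> finite (?l W) \<longrightarrow>
      {..<card B} \<subseteq> col ` ?l W" ..
  have seen: "\<exists>e\<in>B'. col e = c" if B': "B' \<in> ?\<BB>" "c < card B" for B' c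
  proof -
    obtain W where W: "W \<in> down_sets G" "W \<noteq> {}" "W \<noteq> verts G" "B' = ?l W"
      using B' dicut_iff_leaving by blast
    have "{..<card B} \<subseteq> col ` B'"
      using col[rule_format, OF W(1-3)] B'(1) unfolding W(4) by blast
    then have "c \<in> col ` B'" using B'(2) by blast
    then show ?thesis by blast
  qed
  define J where "J c = {e \<in> arcs G. col e = c}" for c
  let ?\<J> = "J ` {..<card B}"
  have dicut_arcs: "B' \<subseteq> arcs G" if "B' \<in> ?\<BB>" for B'
    using that by (auto simp: dicut_iff_leaving leaving_def)
  have hit: "J c \<inter> B' \<noteq> {}" if "B' \<in> ?\<BB>" "c < card B" for B' c
    using seen[OF that] dicut_arcs[OF that(1)] by (auto simp: J_def)
  have "disjoint_dijoins G ?\<BB> ?\<J>"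
    unfolding disjoint_dijoins_def
  proof (intro conjI ballI)
    show "dijoin G ?\<BB> F" if "F \<in> ?\<J>" for F
      using that hit unfolding dijoin_def by (auto simp: J_def)
    show "pairwise disjnt ?\<J>" by (auto simp: pairwise_def disjnt_def J_def)
  qed
  moreover have iso: "|B| =o |?\<J>|"
  proof (rule card_eq_imp_ordIso)
    have "inj_on J {..<card B}" using hit[OF B] by (intro inj_onI) (auto simp: J_def)
    then show "card B = card ?\<J>" by (simp add: card_image)
  qed (use B in auto)
  moreover have "|\<J>'| \<le>o |?\<J>|" if J': "disjoint_dijoins G ?\<BB> \<J>'" for \<J>'
  proof -
    have "\<forall>F\<in>\<J>'. \<exists>e. e \<in> F \<and> e \<in> B" using J' B unfolding disjoint_dijoins_def dijoin_def by blast
    then obtain g where g: "\<And>F. F \<in> \<J>' \<Longrightarrow> g F \<in> F \<and> g F \<in> B" by metis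
    have "inj_on g \<J>'"
      using J' g unfolding disjoint_dijoins_def pairwise_def disjnt_iff by (intro inj_onI) metis
    then have "|\<J>'| \<le>o |B|" using g by (intro card_of_ordLeqI[of g]) auto
    then show ?thesis using iso by (rule ordLeq_ordIso_trans)
  qed
  moreover have "|B| \<le>o |B'|" if "B' \<in> ?\<BB>" for B'
    using card_le_imp_ordLeq[OF _ _ min[OF that]] B that by auto
  ultimately show ?thesis unfolding woodall_def using B by blast
qed

lemma cap_sum_eq: "cap_sum c B = |SIGMA e : B. Field (c e)|"
  by (simp add: cap_sum_def Csum_def Field_card_of)

lemma finite_capacity_iff: "finite_capacity c B \<longleftrightarrow> finite (SIGMA e : B. Field (c e))"
  by (simp add: finite_capacity_def cap_sum_eq Field_card_of)

text \<open>
Each dijoin of the family picks an edge of \<open>B\<close>, and the dijoins that pick the edge \<open>e\<close> inject into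
\<open>Field (c e)\<close>.
\<close>

lemma c_disjoint_dijoins_at_most_capacity:
  fixes c :: "'b \<Rightarrow> 'k rel"
  assumes cap: "capacity D c" and fam: "c_disjoint_dijoins D \<BB> c I F" and B: "B \<in> \<BB>"
  shows "|I| \<le>o cap_sum c B"
proof -
  have "\<forall>i\<in>I. \<exists>e. e \<in> F i \<and> e \<in> arcs D \<and> e \<in> B"
    using fam B unfolding c_disjoint_dijoins_def dijoin_def by blast
  then obtain g where g: "\<And>i. i \<in> I \<Longrightarrow> g i \<in> F i \<and> g i \<in> arcs D \<and> g i \<in> B" by metis
  have "\<exists>h. inj_on h {i \<in> I. e \<in> F i} \<and> h ` {i \<in> I. e \<in> F i} \<subseteq> Field (c e)"
    if e: "e \<in> arcs D" for e
  proof -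
    have "|{i \<in> I. e \<in> F i}| \<le>o c e" "Card_order (c e)"
      using fam cap e by (auto simp: c_disjoint_dijoins_def c_disjoint_def capacity_def)
    then have "|{i \<in> I. e \<in> F i}| \<le>o |Field (c e)|"
      by (blast intro: card_of_Field_ordIso ordIso_symmetric ordLeq_ordIso_trans)
    then show ?thesis by (simp only: card_of_ordLeq[symmetric])
  qed
  then obtain h where h: "\<And>e. e \<in> arcs D \<Longrightarrow>
      inj_on (h e) {i \<in> I. e \<in> F i} \<and> h e ` {i \<in> I. e \<in> F i} \<subseteq> Field (c e)" by metis
  show ?thesis
    unfolding cap_sum_eq
  proof (rule card_of_ordLeqI[of "\<lambda>i. (g i, h (g i) i)"])
    show "(g i, h (g i) i) \<in> (SIGMA e : B. Field (c e))" if "i \<in> I" for i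
    proof -
      have "i \<in> {j \<in> I. g i \<in> F j}" using g[OF that] that by simp
      then show ?thesis using h[of "g i"] g[OF that] by blast
    qed
    show "inj_on (\<lambda>i. (g i, h (g i) i)) I"
    proof (rule inj_onI)
      fix i j assume ij: "i \<in> I" "j \<in> I" "(g i, h (g i) i) = (g j, h (g j) j)"
      have "i \<in> {k \<in> I. g i \<in> F k}" "j \<in> {k \<in> I. g i \<in> F k}"
        using ij g[of i] g[of j] by auto
      moreover have "inj_on (h (g i)) {k \<in> I. g i \<in> F k}" using h g[OF ij(1)] by blast
      moreover have "g i = g j" "h (g i) i = h (g j) j" using ij(3) by auto
      then have "h (g i) i = h (g i) j" by simp
      ultimately show "i = j" by (meson inj_onD)
    qed
  qed
qed

text \<open>
The copies of the edges of a dicut of minimum capacity serve as index set; its bijection \<open>b\<close> with the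
colours makes the \<open>i\<close>-th dijoin consist of the edges with a copy of colour \<open>b i\<close>.
\<close>

lemma (in wf_digraph) woodall_wrt_finite_capacity_dicuts:
  fixes c :: "'b \<Rightarrow> 'k rel"
  assumes ssc: "source_sink_connected G" and cap: "capacity G c"
    and ne: "{B. dicut G B \<and> finite_capacity c B} \<noteq> {}"
  shows "woodall_wrt G {B. dicut G B \<and> finite_capacity c B} c"
proof -
  let ?\<BB> = "{B. dicut G B \<and> finite_capacity c B}"
  let ?\<Sigma> = "\<lambda>B. SIGMA e : B. Field (c e)"
  let ?l = "leaving (?\<Sigma> (arcs G)) (tail G \<circ> fst) (head G \<circ> fst)"
  obtain B where B: "B \<in> ?\<BB>" and min: "\<And>B'. B' \<in> ?\<BB> \<Longrightarrow> card (?\<Sigma> B) \<le> card (?\<Sigma> B')"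
    using ex_has_least_nat[of "\<lambda>B. B \<in> ?\<BB>" _ "\<lambda>B. card (?\<Sigma> B)"] ne by blast
  define k where "k = card (?\<Sigma> B)"
  have finB: "finite (?\<Sigma> B)" using B by (simp add: finite_capacity_iff)
  have copies: "?l W = ?\<Sigma> (leaving (arcs G) (tail G) (head G) W)" for W
    by (auto simp: leaving_def)
  have "\<exists>col. \<forall>W\<in>down_sets G. W \<noteq> {} \<longrightarrow> W \<noteq> verts G \<longrightarrow> finite (?l W) \<longrightarrow> {..<k} \<subseteq> col ` ?l W"
  proof (rule dicut_colouring[OF ssc])
    show "fst ` ?\<Sigma> (arcs G) \<subseteq> arcs G" by auto
    fix W assume W: "W \<in> down_sets G" "W \<noteq> {}" "W \<noteq> verts G" "finite (?l W)"
    then have "leaving (arcs G) (tail G) (head G) W \<in> ?\<BB>"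
      using dicut_iff_leaving unfolding copies finite_capacity_iff by blast
    then show "k \<le> card (?l W)" unfolding k_def copies by (rule min)
  qed
  then obtain col where col: "\<forall>W\<in>down_sets G. W \<noteq> {} \<longrightarrow> W \<noteq> verts G \<longrightarrow> finite (?l W) \<longrightarrow>
      {..<k} \<subseteq> col ` ?l W" ..
  have hit: "\<exists>e\<in>B'. \<exists>x\<in>Field (c e). col (e, x) = j" if B': "B' \<in> ?\<BB>" "j < k" for B' j
  proof -
    obtain W where W: "W \<in> down_sets G" "W \<noteq> {}" "W \<noteq> verts G"
      "B' = leaving (arcs G) (tail G) (head G) W" using B' dicut_iff_leaving by blast
    have eq: "?l W = ?\<Sigma> B'" unfolding copies W(4) ..
    then have "finite (?l W)" using B'(1) by (simp add: finite_capacity_iff)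
    from col[rule_format, OF W(1-3) this] have "{..<k} \<subseteq> col ` ?\<Sigma> B'" unfolding eq .
    then have "j \<in> col ` ?\<Sigma> B'" using B'(2) by blast
    then show ?thesis by auto
  qed
  have "card (?\<Sigma> B) = card {..<k}" unfolding k_def card_lessThan ..
  then obtain b where b: "bij_betw b (?\<Sigma> B) {..<k}"
    using finite_same_card_bij[OF finB finite_lessThan] by blast
  define F where "F i = {e \<in> arcs G. \<exists>x\<in>Field (c e). col (e, x) = b i}" for i
  have "c_disjoint_dijoins G ?\<BB> c (?\<Sigma> B) F"
    unfolding c_disjoint_dijoins_def c_disjoint_def
  proof (intro conjI ballI)
    fix i assume "i \<in> ?\<Sigma> B"
    then have bi: "b i < k" using b by (auto simp: bij_betw_def)
    have "F i \<inter> B' \<noteq> {}" if "B' \<in> ?\<BB>" for B'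
    proof -
      have "B' \<subseteq> arcs G" using that by (auto simp: dicut_iff_leaving leaving_def)
      then show ?thesis using hit[OF that bi] by (auto simp: F_def)
    qed
    then show "dijoin G ?\<BB> (F i)" unfolding dijoin_def by (auto simp: F_def)
  next
    fix e assume e: "e \<in> arcs G"
    let ?I = "{i \<in> ?\<Sigma> B. e \<in> F i}"
    have "\<forall>i\<in>?I. \<exists>x. x \<in> Field (c e) \<and> col (e, x) = b i" by (auto simp: F_def)
    then obtain x where x: "\<And>i. i \<in> ?I \<Longrightarrow> x i \<in> Field (c e) \<and> col (e, x i) = b i" by metis
    have "inj_on x ?I"
    proof (rule inj_onI)
      fix i j assume ij: "i \<in> ?I" "j \<in> ?I" "x i = x j"
      then have "b i = b j" using x[OF ij(1)] x[OF ij(2)] by simp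
      then show "i = j" using b ij(1,2) by (auto simp: bij_betw_def inj_on_def)
    qed
    then have "|?I| \<le>o |Field (c e)|" using x by (intro card_of_ordLeqI[of x]) auto
    moreover have "|Field (c e)| =o c e"
      using cap e by (intro card_of_Field_ordIso) (simp add: capacity_def)
    ultimately show "|?I| \<le>o c e" by (rule ordLeq_ordIso_trans)
  qed
  moreover have "\<forall>I' F'. c_disjoint_dijoins G ?\<BB> c I' F' \<longrightarrow> |I' :: ('b \<times> 'k) set| \<le>o |?\<Sigma> B|"
    using c_disjoint_dijoins_at_most_capacity[OF cap _ B] unfolding cap_sum_eq by blast
  moreover have "\<forall>B'\<in>?\<BB>. cap_sum c B \<le>o cap_sum c B'"
    using card_le_imp_ordLeq[OF finB _ min] unfolding cap_sum_eq finite_capacity_iff by blast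
  moreover have "cap_sum c B =o |?\<Sigma> B|" unfolding cap_sum_eq by (rule card_of_refl)
  ultimately show ?thesis unfolding woodall_wrt_def using B by blast
qed

theorem corollary6p11:
  fixes D :: "('a, 'b) pre_digraph"
  assumes "loopfree_digraph D"
    and "Digraph_Component.connected D"
    and "source_sink_connected D"
  shows "({B. dicut D B \<and> finite B} \<noteq> {} \<longrightarrow> woodall D {B. dicut D B \<and> finite B}) \<and>
    (\<forall>c :: 'b \<Rightarrow> 'k rel. capacity D c \<longrightarrow> {B. dicut D B \<and> finite_capacity c B} \<noteq> {} \<longrightarrow>
       woodall_wrt D {B. dicut D B \<and> finite_capacity c B} c)"
proof -
  interpret loopfree_digraph D by fact
  show ?thesis
    using woodall_finite_dicuts[OF assms(3)] woodall_wrt_finite_capacity_dicuts[OF assms(3)] by blast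
qed

end
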